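(* Let $(g_{ab}(t), k_{ab}(t), f(t,p))$ be any $C^\infty$ solution, with $C^\infty$ initial data at time $t_0$, of the Einstein–Vlasov system with Bianchi I symmetry described in the context (vanishing cosmological constant, particles of equal mass $m>0$, non-zero distribution function, and time orientation chosen so that $H<0$). Assume that $F(t_0)$ and $P(t_0)$ are sufficiently small. Then at late times $$H(t) = -2t^{-1}\bigl(1+O(t^{-1})\bigr),\qquad P(t)=O\bigl(t^{-\frac{2}{3}+\epsilon}\bigr),\qquad F(t)=O(t^{-2}),$$ where $\epsilon$ denotes a small strictly positive constant.
   Context: Signature $(-,+,+,+)$, geometrized units ($G=c=1$), Latin indices run from 1 to 3 and repeated indices are summed. Bianchi I spacetime in Gaussian coordinates: $^4g=-dt^2+g_{ab}(t)dx^adx^b$ on $\mathbb{R}\times\mathbb{R}^3$ (times in an interval), with $g_{ab}$ depending only on $t$; a dot denotes $d/dt$. The second fundamental form $k_{ab}$ is defined by $\dot g_{ab}=-2k_{ab}$; indices are raised and lowered with $g_{ab}$; $H=g^{ab}k_{ab}$ is the mean curvature; $\sigma_{ab}=k_{ab}-\frac{H}{3}g_{ab}$ is its trace-free part. The Einstein–Vlasov system (cosmological constant zero) is: $\dot k_{ab}=Hk_{ab}-2k_{ac}k^c{}_b-8\pi(S_{ab}-\frac12 g_{ab}\,\mathrm{tr}S)-4\pi\rho g_{ab}$ with $\mathrm{tr}S=g^{ab}S_{ab}$; the constraint $-k_{ab}k^{ab}+H^2=16\pi\rho$; $T_{0a}=0$; and the Vlasov equation $\partial_t f+2k^a{}_bp^b\partial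 f/\partial p^a=0$ for a non-negative distribution function $f(t,p)$, $p=(p^1,p^2,p^3)$, independent of $x^a$, on the mass shell $-(p^0)^2+g_{ab}p^ap^b=-m^2$ (all particles have the same mass $m>0$, no collisions), with $\rho=\int f\,(m^2+g_{ab}p^ap^b)^{1/2}(\det g)^{1/2}dp$, $S_{ab}=\int f\,p_ap_b(m^2+g_{cd}p^cp^d)^{-1/2}(\det g)^{1/2}dp$, $T_{0a}=\int f\,p_a(\det g)^{1/2}dp$, $dp=dp^1dp^2dp^3$. The distribution function is not identically zero, and the time orientation is chosen so that $H<0$ for all times (expanding direction). Define $F=\sigma_{ab}\sigma^{ab}/H^2$ and $P(t)=\sup\{(g^{ab}(t)p_ap_b)^{1/2} : f(t,p)\neq 0\}$, where $p_a=g_{ab}p^b$. The origin of the time coordinate is fixed so that $t_0=-2H(t_0)^{-1}$. *)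

theory Defs
  imports "HOL-Analysis.Analysis"
begin

type_synonym mat3 = "real^3^3"
type_synonym vec3 = "real^3"

fun smooth_n :: "nat \<Rightarrow> 'a::real_normed_vector set \<Rightarrow> ('a \<Rightarrow> 'b::real_normed_vector) \<Rightarrow> bool" where
  "smooth_n 0 S h = continuous_on S h"
| "smooth_n (Suc n) S h = ((\<forall>x\<in>S. h differentiable (at x)) \<and>
      (\<forall>v. smooth_n n S (\<lambda>x. frechet_derivative h (at x) v)))"

definition C_infinity_on :: "'a::real_normed_vector set \<Rightarrow> ('a \<Rightarrow> 'b::real_normed_vector) \<Rightarrow> bool" where
  "C_infinity_on S h = (\<forall>n. smooth_n n S h)"

definition mean_curv :: "mat3 \<Rightarrow> mat3 \<Rightarrow> real" where
  "mean_curv g k = trace (matrix_inv g ** k)"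

definition ksq :: "mat3 \<Rightarrow> mat3 \<Rightarrow> real" where
  "ksq g k = trace (matrix_inv g ** k ** matrix_inv g ** k)"

definition sigma :: "mat3 \<Rightarrow> mat3 \<Rightarrow> mat3" where
  "sigma g k = k - (mean_curv g k / 3) *\<^sub>R g"

definition Fshear :: "mat3 \<Rightarrow> mat3 \<Rightarrow> real" where
  "Fshear g k = ksq g (sigma g k) / (mean_curv g k)^2"

text \<open>p^0 = (m^2 + g_{ab} p^a p^b)^{1/2}; p is the contravariant momentum p^a.\<close>
definition energy :: "real \<Rightarrow> mat3 \<Rightarrow> vec3 \<Rightarrow> real" where
  "energy m g p = sqrt (m^2 + p \<bullet> (g *v p))"

definition rho :: "real \<Rightarrow> mat3 \<Rightarrow> (vec3 \<Rightarrow> real) \<Rightarrow> real" where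
  "rho m g fp = (\<integral>p. fp p * energy m g p * sqrt (det g) \<partial>lborel)"

definition Smat :: "real \<Rightarrow> mat3 \<Rightarrow> (vec3 \<Rightarrow> real) \<Rightarrow> mat3" where
  "Smat m g fp = (\<chi> a b. (\<integral>p. fp p * (g *v p) $ a * (g *v p) $ b / energy m g p
                                 * sqrt (det g) \<partial>lborel))"

definition T0 :: "real \<Rightarrow> mat3 \<Rightarrow> (vec3 \<Rightarrow> real) \<Rightarrow> vec3" where
  "T0 m g fp = (\<chi> a. (\<integral>p. fp p * (g *v p) $ a * sqrt (det g) \<partial>lborel))"

definition Pmom :: "mat3 \<Rightarrow> (vec3 \<Rightarrow> real) \<Rightarrow> ereal" where
  "Pmom g fp = Sup ((\<lambda>p. ereal (sqrt ((g *v p) \<bullet> (matrix_inv g *v (g *v p))))) ` {p. fp p \<noteq> 0})"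

definition EV_solution ::
  "real \<Rightarrow> real set \<Rightarrow> (real \<Rightarrow> mat3) \<Rightarrow> (real \<Rightarrow> mat3) \<Rightarrow> (real \<Rightarrow> vec3 \<Rightarrow> real) \<Rightarrow> bool" where
  "EV_solution m I g k f \<longleftrightarrow>
     C_infinity_on I g \<and> C_infinity_on I k \<and> C_infinity_on (I \<times> UNIV) (\<lambda>(t,p). f t p) \<and>
     (\<forall>t\<in>I. transpose (g t) = g t \<and> transpose (k t) = k t \<and>
              (\<forall>x. x \<noteq> 0 \<longrightarrow> x \<bullet> (g t *v x) > 0)) \<and>
     (\<forall>t\<in>I. \<forall>p. f t p \<ge> 0) \<and>
     (\<forall>t\<in>I. (g has_vector_derivative (- 2 *\<^sub>R k t)) (at t)) \<and>
     (\<forall>t\<in>I. (k has_vector_derivative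
          (mean_curv (g t) (k t) *\<^sub>R k t - 2 *\<^sub>R (k t ** matrix_inv (g t) ** k t)
           - (8 * pi) *\<^sub>R (Smat m (g t) (f t)
                 - (1/2 * trace (matrix_inv (g t) ** Smat m (g t) (f t))) *\<^sub>R g t)
           - (4 * pi * rho m (g t) (f t)) *\<^sub>R g t)) (at t)) \<and>
     (\<forall>t\<in>I. - ksq (g t) (k t) + (mean_curv (g t) (k t))^2 = 16 * pi * rho m (g t) (f t)) \<and>
     (\<forall>t\<in>I. T0 m (g t) (f t) = 0) \<and>
     (\<forall>t\<in>I. \<forall>p. \<exists>D. ((\<lambda>(s,q). f s q) has_derivative D) (at (t,p)) \<and>
                     D (1, 2 *\<^sub>R ((matrix_inv (g t) ** k t) *v p)) = 0)"

end

theory Submission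
  imports Defs
begin

text \<open>With \<open>h = - H\<close> and \<open>s = 4 \<pi> tr S / H\<^sup>2\<close> the field equations and the constraint give
  \<open>h' = - h\<^sup>2 (1/2 + 3 F/4 + s)\<close> and \<open>F' \<le> - h F (1 - 3 F/2 - 2 s) + 4 h \<surd>F s\<close>.
  Since \<open>f\<close> is transported along the curves of constant \<open>p\<^sub>a\<close>, it suffices to follow
  \<open>V = g\<^sup>a\<^sup>b p\<^sub>a p\<^sub>b\<close> for fixed \<open>p\<^sub>a\<close>, where \<open>V' \<le> - 2 h (1/3 - \<surd>F) V\<close>, and \<open>s \<le> sup V / (6 m\<^sup>2)\<close>.
  As \<open>h\<close> is decreasing, it serves as the clock: decay rates are powers of \<open>h\<close>, and no integration in \<open>t\<close>
  is required until the end. While \<open>F\<close> stays below a small threshold, \<open>V = O(h)\<close>, hence \<open>s = O(h)\<close>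
  and \<open>F = O(h)\<close> with a small constant, so that the threshold is never reached. Then the errors are
  integrable, which improves the rates to \<open>V = O(h\<^bsup>4/3\<^esup>)\<close> and \<open>F = O(h\<^sup>2)\<close>; finally
  \<open>(1/h - t/2)' = 3 F/4 + s = O(h\<^bsup>4/3\<^esup>)\<close> is integrable, so \<open>1/h = t/2 + O(1)\<close>.\<close>

section \<open>Decay for the reduced scalar system\<close>

text \<open>If \<open>F\<close> ever reached \<open>a\<close>, the compact level set
  \<open>S\<close> would have a least element \<open>x\<close>. By the intermediate value theorem
  \<open>F\<close> cannot exceed \<open>a\<close> before \<open>x\<close> without meeting the level
  earlier, so \<open>step\<close> applies at \<open>x\<close> and contradicts
  \<open>F x = a\<close>.\<close>

lemma bootstrap_bound:
  fixes F :: "real \<Rightarrow> real"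
  assumes cont: "continuous_on {t0..} F" and init: "F t0 < a"
    and step: "\<And>T. t0 \<le> T \<Longrightarrow> (\<And>t. t \<in> {t0..T} \<Longrightarrow> F t \<le> a) \<Longrightarrow> F T < a"
    and "t0 \<le> T"
  shows "F T < a"
proof (rule ccontr)
  assume "\<not> F T < a"
  define S where "S = {t\<in>{t0..T}. F t = a}"
  have "continuous_on {t0..T} F"
    using cont continuous_on_subset by fastforce
  then have "compact S" "S \<noteq> {}"
    using IVT'[of F t0 a T] init \<open>\<not> F T < a\<close> \<open>t0 \<le> T\<close>
      continuous_closed_preimage_constant[of "{t0..T}" F a]
    unfolding S_def by (auto simp: compact_eq_bounded_closed intro: bounded_subset[OF bounded_closed_interval[of t0 T]])
  then obtain x where x: "x \<in> S" "\<And>y. y \<in> S \<Longrightarrow> x \<le> y"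
    by (meson compact_attains_inf)
  have "F t \<le> a" if "t \<in> {t0..x}" for t
  proof (rule ccontr)
    assume "\<not> F t \<le> a"
    moreover have "continuous_on {t0..t} F"
      using cont continuous_on_subset by fastforce
    ultimately obtain y where "t0 \<le> y" "y \<le> t" "F y = a"
      using IVT'[of F t0 a t] init \<open>t \<in> {t0..x}\<close> by force
    with x that have "y = t"
      unfolding S_def by (smt (verit) atLeastAtMost_iff mem_Collect_eq)
    with \<open>F y = a\<close> \<open>\<not> F t \<le> a\<close> show False by simp
  qed
  with step[of x] x(1) show False
    unfolding S_def by force
qed

lemma gronwall_powr:
  fixes h y :: "real \<Rightarrow> real"
  assumes h: "\<And>t. t0 \<le> t \<Longrightarrow> h t > 0"
    "\<And>t. t0 \<le> t \<Longrightarrow> (h has_real_derivative h' t) (at t)"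
    "\<And>t. t0 \<le> t \<Longrightarrow> h' t \<le> - (h t)\<^sup>2 / 2"
    and y: "\<And>t. t0 \<le> t \<Longrightarrow> y t \<ge> 0"
    "\<And>t. t0 \<le> t \<Longrightarrow> (y has_real_derivative y' t) (at t)"
    "\<And>t. t0 \<le> t \<Longrightarrow> y' t \<le> A * h t powr (1 + c) * y t"
    and "A \<ge> 0" "c > 0" "t0 \<le> t"
  shows "y t \<le> y t0 * exp (2 * A / c * h t0 powr c)"
proof -
  define Y where "Y t = y t * exp (2 * A / c * h t powr c)" for t
  have "Y t \<le> Y t0"
  proof (rule DERIV_nonpos_imp_nonincreasing[OF \<open>t0 \<le> t\<close>])
    fix x assume x: "t0 \<le> x" "x \<le> t"
    define e where "e = exp (2 * A / c * h x powr c)"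
    have "(Y has_real_derivative
        (y' x + y x * (2 * A * h x powr (c - 1) * h' x)) * e) (at x)"
      unfolding Y_def e_def
      using h(1)[OF x(1)] \<open>c > 0\<close>
      by (auto intro!: derivative_eq_intros h(2) y(2) x(1) simp: algebra_simps)
    moreover have "(y' x + y x * (2 * A * h x powr (c - 1) * h' x)) * e \<le> 0"
    proof -
      have "h x powr (1 + c) = h x powr (c - 1) * (h x)\<^sup>2"
        using h(1)[OF x(1)] by (simp add: powr_add[symmetric] flip: powr_numeral)
      then have "2 * A * h x powr (c - 1) * h' x \<le> - (A * h x powr (1 + c))"
        using mult_left_mono[OF h(3)[OF x(1)], of "2 * A * h x powr (c - 1)"] \<open>A \<ge> 0\<close> by simp
      then have "y x * (2 * A * h x powr (c - 1) * h' x) \<le> y x * - (A * h x powr (1 + c))"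
        using mult_left_mono y(1)[OF x(1)] by blast
      then have "y' x + y x * (2 * A * h x powr (c - 1) * h' x) \<le> 0"
        using y(3)[OF x(1)] by (simp add: algebra_simps)
      then show ?thesis
        by (simp add: e_def mult_nonpos_nonneg)
    qed
    ultimately show "\<exists>z. (Y has_real_derivative z) (at x) \<and> z \<le> 0" by blast
  qed
  moreover have "y t \<le> Y t"
    using y(1)[OF \<open>t0 \<le> t\<close>] \<open>A \<ge> 0\<close> \<open>c > 0\<close> unfolding Y_def
    by (simp add: mult_le_cancel_left1)
  ultimately show ?thesis by (simp add: Y_def)
qed

text \<open>In terms of the spacetime, \<open>h = - H\<close>, \<open>s = 4 \<pi> tr S / H\<^sup>2\<close>, and \<open>V q = g\<^sup>a\<^sup>b q\<^sub>a q\<^sub>b\<close> for the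
  covariant momenta \<open>q\<close>, conserved along characteristics, that occur in the support of the distribution.\<close>

locale reduced_system =
  fixes h F s F' :: "real \<Rightarrow> real" and V V' :: "'q \<Rightarrow> real \<Rightarrow> real" and Q :: "'q set"
    and t0 m R :: real
  assumes h_pos: "t0 \<le> t \<Longrightarrow> h t > 0"
    and F_nonneg: "t0 \<le> t \<Longrightarrow> F t \<ge> 0"
    and s_nonneg: "t0 \<le> t \<Longrightarrow> s t \<ge> 0"
    and V_nonneg: "\<lbrakk>q \<in> Q; t0 \<le> t\<rbrakk> \<Longrightarrow> V q t \<ge> 0"
    and m_pos: "m > 0"
    and h_deriv: "t0 \<le> t \<Longrightarrow>
      (h has_real_derivative - (h t)\<^sup>2 * (1/2 + 3/4 * F t + s t)) (at t)"
    and F_deriv: "t0 \<le> t \<Longrightarrow> (F has_real_derivative F' t) (at t)"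
    and F'_le: "t0 \<le> t \<Longrightarrow>
      F' t \<le> - h t * F t * (1 - 3/2 * F t - 2 * s t) + 4 * h t * sqrt (F t) * s t"
    and V_deriv: "\<lbrakk>q \<in> Q; t0 \<le> t\<rbrakk> \<Longrightarrow> (V q has_real_derivative V' q t) (at t)"
    and V'_le: "\<lbrakk>q \<in> Q; t0 \<le> t\<rbrakk> \<Longrightarrow> V' q t \<le> - 2 * h t * (1/3 - sqrt (F t)) * V q t"
    and s_le: "\<lbrakk>t0 \<le> t; r \<ge> 0; \<And>q. q \<in> Q \<Longrightarrow> V q t \<le> r\<rbrakk> \<Longrightarrow> s t \<le> r / (6 * m\<^sup>2)"
    and R_nonneg: "R \<ge> 0"
    and V_init: "q \<in> Q \<Longrightarrow> V q t0 \<le> R"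
    and R_small: "R / (6 * m\<^sup>2) \<le> 1/1000"
    and F_init: "F t0 < 1/1000"
begin

section \<open>Bootstrap: the shear stays below its threshold\<close>

lemma h'_le: "t0 \<le> t \<Longrightarrow> - (h t)\<^sup>2 * (1/2 + 3/4 * F t + s t) \<le> - (h t)\<^sup>2 / 2"
  using F_nonneg[of t] s_nonneg[of t] mult_left_mono[of "1/2" "1/2 + 3/4 * F t + s t" "(h t)\<^sup>2"]
  by simp

lemma h_antimono: "h b \<le> h a" if "t0 \<le> a" "a \<le> b"
  by (rule DERIV_nonpos_imp_nonincreasing[OF that(2)])
    (use that h_deriv h'_le in \<open>smt (verit) half_gt_zero_iff zero_le_power2\<close>)

text \<open>Fixes the numerical margin of the bootstrap: \<open>1/20\<close> is small enough that
  \<open>2 * (1/3 - 1/20) = 17/30\<close> still exceeds the leading decay coefficient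
  \<open>1/2\<close> of \<open>h\<close>.\<close>

lemma sqrt_F_le: "F t \<le> 1/400 \<Longrightarrow> sqrt (F t) \<le> 1/20"
  by (intro real_le_lsqrt) (auto simp: power2_eq_square)

text \<open>Below the threshold the factor \<open>1/3 - sqrt (F t)\<close> is positive, so each
  \<open>V q\<close> decreases. This crude bound serves to keep \<open>s\<close> small, which the
  finer comparison with \<open>h\<close> requires.\<close>

lemma V_le_initial:
  assumes small: "\<And>t. t \<in> {t0..T} \<Longrightarrow> F t \<le> 1/400"
    and "q \<in> Q" "t0 \<le> T"
  shows "V q T \<le> R"
proof -
  have "V q T \<le> V q t0"
  proof (rule DERIV_nonpos_imp_nonincreasing[OF \<open>t0 \<le> T\<close>])
    fix t assume t: "t0 \<le> t" "t \<le> T"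
    have "V' q t \<le> - 2 * h t * (1/3 - sqrt (F t)) * V q t"
      by (rule V'_le) (use t \<open>q \<in> Q\<close> in auto)
    also have "\<dots> \<le> 0"
      using h_pos[OF t(1)] V_nonneg[OF \<open>q \<in> Q\<close> t(1)] sqrt_F_le[OF small[of t]] t
      by (simp add: mult_nonpos_nonneg mult_nonneg_nonneg)
    finally show "\<exists>D. (V q has_real_derivative D) (at t) \<and> D \<le> 0"
      using V_deriv[OF \<open>q \<in> Q\<close> t(1)] by blast
  qed
  then show ?thesis using V_init[OF \<open>q \<in> Q\<close>] by simp
qed

lemma s_le_if_F_small:
  assumes small: "\<And>t. t \<in> {t0..T} \<Longrightarrow> F t \<le> 1/400" and "t0 \<le> T"
  shows "s T \<le> 1/1000"
  using s_le[OF \<open>t0 \<le> T\<close> R_nonneg V_le_initial] assms R_small by force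

text \<open>The logarithmic decay rate of \<open>V q\<close> is at least \<open>17/30 * h\<close>,
  that of \<open>h\<close> at most \<open>(1/2 + 3/1600 + 1/1000) * h\<close>. The first is larger,
  hence the quotient decreases.\<close>

lemma V_over_h_antimono:
  assumes small: "\<And>t. t \<in> {t0..T} \<Longrightarrow> F t \<le> 1/400"
    and "q \<in> Q" "t0 \<le> T"
  shows "V q T / h T \<le> V q t0 / h t0"
proof (rule DERIV_nonpos_imp_nonincreasing[OF \<open>t0 \<le> T\<close>])
  fix t assume t: "t0 \<le> t" "t \<le> T"
  let ?D = "(V' q t + h t * (1/2 + 3/4 * F t + s t) * V q t) / h t"
  have "((\<lambda>t. V q t / h t) has_real_derivative ?D) (at t)"
    using h_pos[OF t(1)]
    by (auto intro!: derivative_eq_intros V_deriv h_deriv t \<open>q \<in> Q\<close> simp: field_simps power2_eq_square)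
  moreover have "?D \<le> 0"
  proof -
    have "s t \<le> 1/1000"
      using s_le_if_F_small[of t] small t by simp
    then have "- 2 * (1/3 - sqrt (F t)) + (1/2 + 3/4 * F t + s t) \<le> 0"
      using small[of t] sqrt_F_le[of t] t by simp
    then have "h t * V q t * (- 2 * (1/3 - sqrt (F t)) + (1/2 + 3/4 * F t + s t)) \<le> 0"
      using h_pos[OF t(1)] V_nonneg[OF \<open>q \<in> Q\<close> t(1)] by (simp add: mult_nonneg_nonpos)
    then have "V' q t + h t * (1/2 + 3/4 * F t + s t) * V q t \<le> 0"
      using V'_le[OF \<open>q \<in> Q\<close> t(1)] by (simp add: algebra_simps)
    then show ?thesis
      using h_pos[OF t(1)] by (simp add: divide_nonpos_pos)
  qed
  ultimately show "\<exists>D. ((\<lambda>t. V q t / h t) has_real_derivative D) (at t) \<and> D \<le> 0" by blast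
qed

lemma s_le_h_if_F_small:
  assumes small: "\<And>t. t \<in> {t0..T} \<Longrightarrow> F t \<le> 1/400" and "t0 \<le> T"
  shows "s T \<le> 1/1000 * (h T / h t0)"
proof -
  have "V q T \<le> R * (h T / h t0)" if "q \<in> Q" for q
  proof -
    have "V q T / h T \<le> R / h t0"
      using V_over_h_antimono[OF small that \<open>t0 \<le> T\<close>] V_init[OF that] h_pos[of t0]
      by (smt (verit) divide_right_mono)
    then show ?thesis
      using h_pos[OF \<open>t0 \<le> T\<close>] by (simp add: field_simps)
  qed
  then have "s T \<le> R * (h T / h t0) / (6 * m\<^sup>2)"
    using R_nonneg h_pos[of t0] h_pos[OF \<open>t0 \<le> T\<close>] by (intro s_le \<open>t0 \<le> T\<close>) auto
  also have "\<dots> = R / (6 * m\<^sup>2) * (h T / h t0)" by simp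
  also have "\<dots> \<le> 1/1000 * (h T / h t0)"
    using R_small h_pos[of t0] h_pos[OF \<open>t0 \<le> T\<close>] by (intro mult_right_mono) auto
  finally show ?thesis .
qed

text \<open>Up to small errors \<open>F / h\<close> decays at rate \<open>h / 2\<close>. Half of
  this margin pays for the part of the source that is linear in \<open>F\<close>; the rest of the
  source is of order \<open>h^2\<close> and is paid for by the decrease of the added term
  \<open>c * h\<close>.\<close>

lemma F_over_h_le:
  assumes small: "\<And>t. t \<in> {t0..T} \<Longrightarrow> F t \<le> 1/400" and "t0 \<le> T"
  shows "F T / h T < 1 / (500 * h t0)"
proof -
  \<comment> \<open>Chosen so that \<open>c * h^2 / 2\<close> equals
    \<open>16 * (h / (1000 * h t0))^2\<close>, the bound on \<open>16 * s^2\<close> obtained from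
    \<open>s_le_h_if_F_small\<close>.\<close>
  define c where "c = 32 / (1000 * h t0)\<^sup>2"
  have "F T / h T + c * h T \<le> F t0 / h t0 + c * h t0"
  proof (rule DERIV_nonpos_imp_nonincreasing[OF \<open>t0 \<le> T\<close>])
    fix t assume t: "t0 \<le> t" "t \<le> T"
    let ?h' = "- (h t)\<^sup>2 * (1/2 + 3/4 * F t + s t)"
    let ?D = "F' t / h t + F t * (1/2 + 3/4 * F t + s t) + c * ?h'"
    have "((\<lambda>t. F t / h t + c * h t) has_real_derivative ?D) (at t)"
      using h_pos[OF t(1)]
      by (auto intro!: derivative_eq_intros F_deriv h_deriv t simp: field_simps power2_eq_square)
    moreover have "?D \<le> 0"
    proof -
      have hp: "h t > 0" and hp0: "h t0 > 0" using h_pos t by auto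
      have Fs: "F t \<ge> 0" "s t \<ge> 0" "F t \<le> 1/400" "s t \<le> 1/1000"
        using F_nonneg[OF t(1)] s_nonneg[OF t(1)] small[of t] s_le_if_F_small[of t] small t by auto
      have "F' t / h t \<le> (- h t * F t * (1 - 3/2 * F t - 2 * s t) + 4 * h t * sqrt (F t) * s t) / h t"
        using F'_le[OF t(1)] hp by (intro divide_right_mono) auto
      also have "\<dots> = - F t * (1 - 3/2 * F t - 2 * s t) + 4 * sqrt (F t) * s t"
        using hp by (simp add: field_simps)
      \<comment> \<open>Young's inequality; the weight leaves the coefficient
        \<open>-1 + 1/2 + 1/4 = -1/4\<close> in front of \<open>F\<close>, enough to beat the small
        terms \<open>9/4 * F + 3 * s\<close>.\<close>
      also have "4 * sqrt (F t) * s t \<le> F t / 4 + 16 * (s t)\<^sup>2"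
        using zero_le_power2[of "sqrt (F t) / 2 - 4 * s t"] Fs
        by (simp add: power2_diff power_divide power_mult_distrib algebra_simps)
      finally have "F' t / h t + F t * (1/2 + 3/4 * F t + s t)
          \<le> F t * (9/4 * F t + 3 * s t - 1/4) + 16 * (s t)\<^sup>2"
        by (simp add: algebra_simps power2_eq_square)
      moreover have "F t * (9/4 * F t + 3 * s t - 1/4) \<le> 0"
        using Fs by (intro mult_nonneg_nonpos) auto
      moreover have "16 * (s t)\<^sup>2 \<le> c * (h t)\<^sup>2 / 2"
      proof -
        have "(s t)\<^sup>2 \<le> (1/1000 * (h t / h t0))\<^sup>2"
          using Fs s_le_h_if_F_small[of t] small t by (intro power_mono) auto
        then show ?thesis by (simp add: c_def power_divide power_mult_distrib)
      qed
      moreover have "c * ?h' \<le> c * (- (h t)\<^sup>2 / 2)"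
        using h'_le[OF t(1)] by (intro mult_left_mono) (auto simp: c_def)
      ultimately show ?thesis by simp
    qed
    ultimately show "\<exists>D. ((\<lambda>t. F t / h t + c * h t) has_real_derivative D) (at t) \<and> D \<le> 0"
      by blast
  qed
  moreover have "c * h T \<ge> 0" using h_pos[OF \<open>t0 \<le> T\<close>] by (simp add: c_def)
  moreover have "F t0 / h t0 < 1/1000 / h t0"
    using F_init h_pos[of t0] by (intro divide_strict_right_mono) auto
  moreover have "c * h t0 = 32/1000000 / h t0"
    using h_pos[of t0] by (simp add: c_def power2_eq_square)
  moreover have "1/1000 / h t0 + 32/1000000 / h t0 \<le> 1 / (500 * h t0)"
    using h_pos[of t0] by (simp add: field_simps)
  ultimately show ?thesis by linarith
qed

lemma F_small:
  assumes "t0 \<le> t"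
  shows "F t < 1/400"
proof (rule bootstrap_bound[OF _ _ _ assms])
  show "continuous_on {t0..} F"
    using DERIV_isCont[OF F_deriv] by (intro continuous_at_imp_continuous_on) auto
  fix T assume T: "t0 \<le> T" "\<And>t. t \<in> {t0..T} \<Longrightarrow> F t \<le> 1/400"
  \<comment> \<open>Since \<open>h T \<le> h t0\<close>, this gives \<open>F T < 1/500\<close>,
    strictly better than the assumed \<open>1/400\<close>, and the bootstrap closes.\<close>
  have "F T < h T / (500 * h t0)"
    using F_over_h_le[OF T(2,1)] h_pos[OF T(1)] by (simp add: field_simps)
  also have "\<dots> \<le> 1/400"
    using h_antimono[OF _ T(1)] h_pos[of t0] h_pos[OF T(1)] by (simp add: field_simps)
  finally show "F T < 1/400" .
qed (use F_init in simp)

text \<open>Once \<open>F_small\<close> holds for all times, the conditional estimates become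
  unconditional. The constant for \<open>F\<close> is the larger one and serves for \<open>s\<close>
  too. This first decay rate is what makes the error terms below integrable.\<close>

lemma F_s_le_h:
  obtains B where "B > 0" "\<And>t. t0 \<le> t \<Longrightarrow> F t \<le> B * h t" "\<And>t. t0 \<le> t \<Longrightarrow> s t \<le> B * h t"
proof
  fix t assume t: "t0 \<le> t"
  have small: "F u \<le> 1/400" if "u \<in> {t0..t}" for u
    using F_small that by fastforce
  show "F t \<le> (1 / (500 * h t0)) * h t"
    using F_over_h_le[OF small t] h_pos[OF t] by (simp add: field_simps)
  show "s t \<le> (1 / (500 * h t0)) * h t"
    using s_le_h_if_F_small[OF small t] h_pos[OF t] h_pos[of t0] by (simp add: field_simps)
qed (use h_pos[of t0] in simp)

section \<open>Improved decay rates\<close>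

text \<open>For \<open>F = s = 0\<close> the extremal rates are \<open>V' / V = - 2/3 * h\<close>
  and \<open>h' / h = - h / 2\<close>, whence the exponent \<open>4/3\<close>. The deviations from
  these rates are of order \<open>sqrt F = O(h powr (1/2))\<close>, so \<open>gronwall_powr\<close>
  applies to \<open>V / h powr (4/3)\<close> with \<open>c = 1/2\<close>. The constant is uniform in
  \<open>q\<close> because \<open>R\<close> bounds all initial values.\<close>

lemma V_decay:
  obtains C where "C \<ge> 0" "\<And>q t. \<lbrakk>q \<in> Q; t0 \<le> t\<rbrakk> \<Longrightarrow> V q t \<le> C * h t powr (4/3)"
proof -
  obtain B where B: "B > 0" "\<And>t. t0 \<le> t \<Longrightarrow> F t \<le> B * h t" "\<And>t. t0 \<le> t \<Longrightarrow> s t \<le> B * h t"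
    using F_s_le_h by blast
  \<comment> \<open>The first summand bounds the error \<open>2 * sqrt F\<close>, the second the
    error \<open>4/3 * (3/4 * F + s)\<close>, after half a power of \<open>h\<close> has been traded
    for its initial value.\<close>
  define A where "A = 2 * sqrt B + 8/3 * B * h t0 powr (1/2)"
  define C where "C = R * h t0 powr (- (4/3)) * exp (2 * A / (1/2) * h t0 powr (1/2))"
  have "V q t \<le> C * h t powr (4/3)" if "q \<in> Q" "t0 \<le> t" for q t
  proof -
    have "V q t * h t powr (- (4/3)) \<le>
        V q t0 * h t0 powr (- (4/3)) * exp (2 * A / (1/2) * h t0 powr (1/2))"
    proof (rule gronwall_powr[where h = h, OF h_pos h_deriv h'_le])
      fix t assume t: "t0 \<le> t"
      let ?D = "1/2 + 3/4 * F t + s t"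
      note hp = h_pos[OF t]
      show "V q t * h t powr (- (4/3)) \<ge> 0"
        using V_nonneg[OF \<open>q \<in> Q\<close> t] by simp
      have e: "h t powr (- (7/3)) * (h t)\<^sup>2 = h t powr (- (4/3)) * h t"
        using powr_add[of "h t" "- (7/3)" 2] powr_add[of "h t" "- (4/3)" 1] hp by simp
      show "((\<lambda>t. V q t * h t powr (- (4/3))) has_real_derivative
          (V' q t + 4/3 * h t * ?D * V q t) * h t powr (- (4/3))) (at t)"
        by (rule derivative_eq_intros V_deriv h_deriv t \<open>q \<in> Q\<close> hp refl)+
          (use e[THEN arg_cong, of "\<lambda>z. 4/3 * V q t * ?D * z"] in \<open>simp add: algebra_simps\<close>)
      have r: "sqrt (F t) \<le> sqrt B * h t powr (1/2)"
        using real_sqrt_le_mono[OF B(2)[OF t]] hp by (simp add: real_sqrt_mult powr_half_sqrt)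
      have "h t = h t powr (1/2) * h t powr (1/2)"
        using hp by (simp add: powr_add[symmetric])
      also have "\<dots> \<le> h t0 powr (1/2) * h t powr (1/2)"
        using hp h_antimono[OF _ t] by (intro mult_right_mono powr_mono2) auto
      finally have "2 * B * h t \<le> 2 * B * (h t0 powr (1/2) * h t powr (1/2))"
        using B(1) by simp
      then have d: "3/4 * F t + s t \<le> 2 * B * (h t0 powr (1/2) * h t powr (1/2))"
        using B(2,3)[OF t] mult_pos_pos[OF B(1) hp] by linarith
      \<comment> \<open>The leading terms \<open>- 2/3\<close> and \<open>4/3 * 1/2\<close> cancel,
        so only error terms are left.\<close>
      have "V' q t + 4/3 * h t * ?D * V q t
          \<le> (h t * V q t) * (2 * sqrt (F t) + 4/3 * (3/4 * F t + s t))"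
        using V'_le[OF \<open>q \<in> Q\<close> t] by (simp add: algebra_simps)
      also have "\<dots> \<le> (h t * V q t) * (A * h t powr (1/2))"
        using r d hp V_nonneg[OF \<open>q \<in> Q\<close> t]
        by (intro mult_left_mono) (auto simp: A_def algebra_simps)
      finally have "V' q t + 4/3 * h t * ?D * V q t \<le> A * h t powr (1 + 1/2) * V q t"
        using hp by (simp only: powr_add) (simp add: algebra_simps)
      from mult_right_mono[OF this, of "h t powr (- (4/3))"]
      show "(V' q t + 4/3 * h t * ?D * V q t) * h t powr (- (4/3))
          \<le> A * h t powr (1 + 1/2) * (V q t * h t powr (- (4/3)))"
        by (simp add: algebra_simps)
    qed (use that B h_pos[of t0] in \<open>auto simp: A_def\<close>)
    also have "\<dots> \<le> C"
      unfolding C_def using V_init[OF \<open>q \<in> Q\<close>] by (intro mult_right_mono) auto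
    finally show ?thesis
      using h_pos[OF \<open>t0 \<le> t\<close>] by (simp add: powr_minus field_simps)
  qed
  moreover have "C \<ge> 0" using R_nonneg by (simp add: C_def)
  ultimately show thesis using that by blast
qed

lemma s_decay:
  obtains C where "C \<ge> 0" "\<And>t. t0 \<le> t \<Longrightarrow> s t \<le> C * h t powr (4/3)"
proof -
  obtain C where C: "C \<ge> 0" "\<And>q t. \<lbrakk>q \<in> Q; t0 \<le> t\<rbrakk> \<Longrightarrow> V q t \<le> C * h t powr (4/3)"
    using V_decay by blast
  have "s t \<le> C / (6 * m\<^sup>2) * h t powr (4/3)" if "t0 \<le> t" for t
    using s_le[OF that, of "C * h t powr (4/3)"] C that by simp
  then show thesis using that[of "C / (6 * m\<^sup>2)"] C(1) by simp
qed

text \<open>As \<open>h\<close> never exceeds its initial value, surplus powers of \<open>h\<close>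
  can be traded for constants; this brings different error terms to one common exponent.\<close>

lemma powr_h_le: "h t powr a \<le> h t0 powr (a - b) * h t powr b" if "t0 \<le> t" "b \<le> a"
proof -
  have "h t powr a = h t powr (a - b) * h t powr b"
    by (simp add: powr_add[symmetric])
  also have "\<dots> \<le> h t0 powr (a - b) * h t powr b"
    using that h_antimono[OF _ that(1)] h_pos[OF that(1)]
    by (intro mult_right_mono powr_mono2) auto
  finally show ?thesis .
qed

text \<open>To leading order \<open>F' / F\<close> is at most \<open>- h\<close> while
  \<open>h' / h\<close> is \<open>- h / 2\<close>, so \<open>F / h^2\<close> is the quantity to
  control. The source \<open>h * sqrt F * s\<close> is not linear in \<open>F\<close>; it is split
  by Young's inequality, using the improved rate of \<open>s\<close>, into a multiple of
  \<open>F\<close> and an inhomogeneous term.\<close>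

lemma F_decay:
  obtains C where "C \<ge> 0" "\<And>t. t0 \<le> t \<Longrightarrow> F t \<le> C * (h t)\<^sup>2"
proof -
  obtain B where B: "B > 0" "\<And>t. t0 \<le> t \<Longrightarrow> F t \<le> B * h t" "\<And>t. t0 \<le> t \<Longrightarrow> s t \<le> B * h t"
    using F_s_le_h by blast
  obtain C where C: "C \<ge> 0" "\<And>t. t0 \<le> t \<Longrightarrow> s t \<le> C * h t powr (4/3)"
    using s_decay by blast
  \<comment> \<open>\<open>A1\<close> collects the coefficients of \<open>F\<close>: the quadratic
    terms \<open>h * (3 * F + 4 * s) \<le> 7 * B * h^2\<close> and the Young weight
    \<open>h powr (3/2)\<close>, both reduced to \<open>h powr (7/6)\<close>. The summand
    \<open>4 * C^2\<close> of \<open>A\<close> comes from the inhomogeneous term.\<close>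
  define A1 where "A1 = 7 * B * h t0 powr (5/6) + h t0 powr (1/3)"
  define A where "A = A1 + 4 * C\<^sup>2"
  have A: "A1 \<ge> 0" "A \<ge> 0" using B(1) by (auto simp: A1_def A_def)
  define Z where "Z = (F t0 / (h t0)\<^sup>2 + 1) * exp (2 * A / (1/6) * h t0 powr (1/6))"
  have "F t \<le> Z * (h t)\<^sup>2" if "t0 \<le> t" for t
  proof -
    \<comment> \<open>Adding 1 lets the inhomogeneous term be bounded by a multiple of the unknown,
      as the homogeneous Gronwall inequality demands.\<close>
    have "F t / (h t)\<^sup>2 + 1 \<le> Z"
      unfolding Z_def
    proof (rule gronwall_powr[where h = h, OF h_pos h_deriv h'_le])
      fix t assume t: "t0 \<le> t"
      let ?D = "1/2 + 3/4 * F t + s t"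
      note hp = h_pos[OF t]
      have F: "F t \<ge> 0" and s: "s t \<ge> 0" using F_nonneg s_nonneg t by auto
      show "F t / (h t)\<^sup>2 + 1 \<ge> 0" using F by simp
      show "((\<lambda>t. F t / (h t)\<^sup>2 + 1) has_real_derivative
          (F' t + 2 * h t * ?D * F t) / (h t)\<^sup>2) (at t)"
        using hp
        by (auto intro!: derivative_eq_intros F_deriv h_deriv t simp: field_simps power2_eq_square)
      \<comment> \<open>The Young weight. A weight \<open>h powr a\<close> produces the rates
        \<open>h powr (1 + a)\<close> and, after division by \<open>h^2\<close>,
        \<open>h powr (5/3 - a)\<close>; both exponents exceed 1 for \<open>0 < a < 2/3\<close>.
        With \<open>a = 1/2\<close> the smaller one is \<open>7/6 = 1 + 1/6\<close>.\<close>
      define k where "k = h t powr (1/2)"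
      have k: "k > 0" "k\<^sup>2 = h t" using hp by (auto simp: k_def powr_half_sqrt)
      have "(sqrt k * sqrt (F t) - 2 * s t / sqrt k)\<^sup>2 = k * F t - 4 * sqrt (F t) * s t + 4 * (s t)\<^sup>2 / k"
        using k(1) F by (simp add: power2_diff power_divide power_mult_distrib)
      then have young: "4 * sqrt (F t) * s t \<le> k * F t + 4 * (s t)\<^sup>2 / k"
        by (smt (verit) zero_le_power2)
      have e1: "h t * h t \<le> h t0 powr (5/6) * h t powr (7/6)"
        using powr_h_le[OF t, of "7/6" 2] hp by (simp add: power2_eq_square)
      have e2: "h t * k \<le> h t0 powr (1/3) * h t powr (7/6)"
        using powr_h_le[OF t, of "7/6" "3/2"] hp by (simp add: k_def powr_mult_base)
      have "F' t + 2 * h t * ?D * F t \<le> h t * (F t * (3 * F t + 4 * s t) + 4 * sqrt (F t) * s t)"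
        using F'_le[OF t] by (simp add: algebra_simps)
      also have "\<dots> \<le> h t * (F t * (3 * F t + 4 * s t) + (k * F t + 4 * (s t)\<^sup>2 / k))"
        using young hp by (intro mult_left_mono) auto
      also have "\<dots> = F t * (h t * (3 * F t + 4 * s t) + h t * k) + 4 * h t * (s t)\<^sup>2 / k"
        by (simp add: algebra_simps)
      also have "h t * (3 * F t + 4 * s t) + h t * k \<le> h t * (7 * B * h t) + h t * k"
        using B(2,3)[OF t] hp by (intro add_mono mult_left_mono) auto
      also have "\<dots> \<le> A1 * h t powr (7/6)"
        using add_mono[OF mult_left_mono[OF e1, of "7 * B"] e2] B(1) by (simp add: A1_def algebra_simps)
      also have "4 * h t * (s t)\<^sup>2 / k \<le> 4 * C\<^sup>2 * h t powr (7/6) * (h t)\<^sup>2"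
      proof -
        have "(s t)\<^sup>2 \<le> (C * h t powr (4/3))\<^sup>2"
          using C(2)[OF t] s by (intro power_mono)
        then have "4 * h t * (s t)\<^sup>2 / k \<le> 4 * h t * (C * h t powr (4/3))\<^sup>2 / k"
          using hp k(1) by (intro divide_right_mono mult_left_mono) auto
        also have "4 * h t * (C * h t powr (4/3))\<^sup>2 / k = 4 * C\<^sup>2 * ((h t powr (4/3))\<^sup>2 * h t / k)"
          by (simp add: power_mult_distrib)
        also have "(h t powr (4/3))\<^sup>2 * h t / k = h t powr (8/3 + 1 - 1/2)"
          using hp by (simp only: powr_diff powr_add) (simp add: k_def power2_eq_square flip: powr_add)
        also have "h t powr (8/3 + 1 - 1/2) = h t powr (7/6) * (h t)\<^sup>2"
          using hp by (simp add: powr_add[symmetric] flip: powr_numeral)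
        finally show ?thesis by simp
      qed
      finally have "F' t + 2 * h t * ?D * F t
          \<le> F t * (A1 * h t powr (7/6)) + 4 * C\<^sup>2 * h t powr (7/6) * (h t)\<^sup>2"
        using F by (simp add: mult_left_mono)
      then have "(F' t + 2 * h t * ?D * F t) / (h t)\<^sup>2
          \<le> (F t * (A1 * h t powr (7/6)) + 4 * C\<^sup>2 * h t powr (7/6) * (h t)\<^sup>2) / (h t)\<^sup>2"
        by (intro divide_right_mono) auto
      also have "\<dots> = A1 * h t powr (7/6) * (F t / (h t)\<^sup>2) + 4 * C\<^sup>2 * h t powr (7/6) * 1"
        using hp by (simp add: add_divide_distrib)
      also have "\<dots> \<le> A1 * h t powr (7/6) * (F t / (h t)\<^sup>2 + 1)
          + 4 * C\<^sup>2 * h t powr (7/6) * (F t / (h t)\<^sup>2 + 1)"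
        using A F by (intro add_mono mult_left_mono) auto
      finally show "(F' t + 2 * h t * ?D * F t) / (h t)\<^sup>2
          \<le> A * h t powr (1 + 1/6) * (F t / (h t)\<^sup>2 + 1)"
        by (simp add: A_def algebra_simps)
    qed (use that A in auto)
    then have "F t / (h t)\<^sup>2 \<le> Z" by simp
    then show ?thesis using h_pos[OF that] by (simp add: field_simps)
  qed
  moreover have "Z \<ge> 0" using F_nonneg[of t0] by (simp add: Z_def)
  ultimately show thesis using that by blast
qed

text \<open>The function \<open>Y = 1 / h - t / 2\<close> has derivative \<open>3/4 * F + s\<close>,
  which is non-negative and \<open>O(h powr (4/3))\<close>. The normalisation
  \<open>h t0 * t0 = 2\<close> says \<open>Y t0 = 0\<close>, so \<open>Y \<ge> 0\<close>, that is
  \<open>h \<le> 2 / t\<close>; the upper bound on \<open>Y\<close> then controls the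
  deviation.\<close>

lemma h_asymp:
  assumes "h t0 * t0 = 2"
  obtains C where "\<And>t. t0 \<le> t \<Longrightarrow> t > 0 \<and> h t \<le> 2 / t \<and> \<bar>h t - 2 / t\<bar> \<le> C * t powr (-2)"
proof -
  obtain B where B: "B > 0" "\<And>t. t0 \<le> t \<Longrightarrow> F t \<le> B * h t" "\<And>t. t0 \<le> t \<Longrightarrow> s t \<le> B * h t"
    using F_s_le_h by blast
  obtain C1 where C1: "C1 \<ge> 0" "\<And>t. t0 \<le> t \<Longrightarrow> s t \<le> C1 * h t powr (4/3)"
    using s_decay by blast
  obtain C2 where C2: "C2 \<ge> 0" "\<And>t. t0 \<le> t \<Longrightarrow> F t \<le> C2 * (h t)\<^sup>2"
    using F_decay by blast
  have t0_pos: "t0 > 0"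
    using assms h_pos[of t0] by (smt (verit) mult_nonneg_nonpos)
  define A where "A = C2 * h t0 powr (2/3) + C1"
  have A: "A \<ge> 0" using C1 C2 by (simp add: A_def)
  define Y where "Y t = 1 / h t - t / 2" for t
  have dY: "(Y has_real_derivative (3/4 * F t + s t)) (at t)" if "t0 \<le> t" for t
    unfolding Y_def using h_pos[OF that]
    by (auto intro!: derivative_eq_intros h_deriv that simp: field_simps power2_eq_square)
  have Y0: "Y t0 = 0"
    using assms h_pos[of t0] by (simp add: Y_def field_simps)
  have Y_nonneg: "Y t \<ge> 0" if "t0 \<le> t" for t
  proof -
    have "Y t0 \<le> Y t"
      by (rule DERIV_nonneg_imp_nondecreasing[OF that])
        (use dY F_nonneg s_nonneg in \<open>force intro: add_nonneg_nonneg\<close>)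
    then show ?thesis by (simp add: Y0)
  qed
  define K where "K = exp (2 * A / (1/3) * h t0 powr (1/3))"
  have Y_le: "Y t \<le> K" if "t0 \<le> t" for t
  proof -
    \<comment> \<open>The derivative bound has no factor \<open>Y\<close>; since
      \<open>Y + 1 \<ge> 1\<close>, it can be put into Gronwall form, here with
      \<open>c = 1/3\<close>.\<close>
    have "Y t + 1 \<le> (Y t0 + 1) * K"
      unfolding K_def
    proof (rule gronwall_powr[where h = h, OF h_pos h_deriv h'_le])
      fix t assume t: "t0 \<le> t"
      show "Y t + 1 \<ge> 0" using Y_nonneg[OF t] by simp
      show "((\<lambda>t. Y t + 1) has_real_derivative (3/4 * F t + s t)) (at t)"
        by (auto intro!: derivative_eq_intros dY t)
      have "3/4 * F t + s t \<le> C2 * (h t)\<^sup>2 + C1 * h t powr (4/3)"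
        using C1(2)[OF t] C2(2)[OF t] F_nonneg[OF t] by simp
      also have "(h t)\<^sup>2 \<le> h t0 powr (2/3) * h t powr (4/3)"
        using powr_h_le[OF t, of "4/3" 2] h_pos[OF t] by simp
      finally have "3/4 * F t + s t \<le> A * h t powr (4/3) * 1"
        using C2(1) by (simp add: A_def distrib_right mult_left_mono mult.assoc)
      also have "\<dots> \<le> A * h t powr (4/3) * (Y t + 1)"
        using A Y_nonneg[OF t] by (intro mult_left_mono) auto
      finally show "3/4 * F t + s t \<le> A * h t powr (1 + 1/3) * (Y t + 1)" by simp
    qed (use that A in auto)
    then show ?thesis by (simp add: Y0)
  qed
  have "t > 0 \<and> h t \<le> 2 / t \<and> \<bar>h t - 2 / t\<bar> \<le> 4 * K * t powr (-2)" if "t0 \<le> t" for t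
  proof (intro conjI)
    show tp: "t > 0" using that t0_pos by simp
    note hp = h_pos[OF that]
    show h_le: "h t \<le> 2 / t"
      using Y_nonneg[OF that] hp tp by (simp add: Y_def field_simps)
    \<comment> \<open>Bounded \<open>Y\<close> and two factors of size at most \<open>2 / t\<close>
      give the quadratic error.\<close>
    have "h t - 2 / t = - (Y t * (h t * (2 / t)))"
      using hp tp by (simp add: Y_def field_simps)
    then have "\<bar>h t - 2 / t\<bar> = Y t * (h t * (2 / t))"
      using Y_nonneg[OF that] hp tp by simp
    also have "\<dots> \<le> K * ((2 / t) * (2 / t))"
      using Y_nonneg[OF that] Y_le[OF that] hp tp h_le
      by (intro mult_mono mult_right_mono) auto
    also have "\<dots> = 4 * K * t powr (-2)"
      using tp by (simp add: powr_minus field_simps power2_eq_square)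
    finally show "\<bar>h t - 2 / t\<bar> \<le> 4 * K * t powr (-2)" .
  qed
  then show thesis using that by blast
qed

end

section \<open>Positive definite matrices\<close>

lemma bounded_bilinear_matrix_mult:
  "bounded_bilinear (\<lambda>(A::real^'n^'m) (B::real^'p^'n). A ** B)"
  unfolding bilinear_conv_bounded_bilinear[symmetric] bilinear_def
  by (auto intro!: linearI simp: matrix_matrix_mult_def vec_eq_iff sum_distrib_left mult_ac sum.distrib ring_distribs)

lemma bounded_linear_trace: "bounded_linear (trace :: real^'n^'n \<Rightarrow> real)"
  unfolding linear_conv_bounded_linear[symmetric]
  by (auto intro!: linearI simp: trace_def sum.distrib sum_distrib_left)

lemma bounded_linear_quadratic_form: "bounded_linear (\<lambda>A::real^'n^'n. x \<bullet> (A *v x))"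
  unfolding linear_conv_bounded_linear[symmetric]
  by (auto intro!: linearI simp: matrix_vector_mult_add_rdistrib
      inner_add_right scaleR_matrix_vector_assoc[symmetric])

lemmas matrix_mult_derivative = bounded_bilinear.has_vector_derivative[OF bounded_bilinear_matrix_mult]
lemmas trace_derivative = bounded_linear.has_vector_derivative[OF bounded_linear_trace]
lemmas matrix_mult_simps =
  bounded_bilinear.diff_right[OF bounded_bilinear_matrix_mult]
  bounded_bilinear.diff_left[OF bounded_bilinear_matrix_mult]
  bounded_bilinear.add_right[OF bounded_bilinear_matrix_mult]
  bounded_bilinear.add_left[OF bounded_bilinear_matrix_mult]
  bounded_bilinear.scaleR_right[OF bounded_bilinear_matrix_mult]
  bounded_bilinear.scaleR_left[OF bounded_bilinear_matrix_mult]
  trace_sub trace_add linear_cmul[OF bounded_linear.linear[OF bounded_linear_trace]]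

lemma bounded_linear_matrix_vector_left: "bounded_linear (\<lambda>A::real^'n^'m. A *v x)"
  unfolding linear_conv_bounded_linear[symmetric]
  by (auto intro!: linearI simp: matrix_vector_mult_add_rdistrib scaleR_matrix_vector_assoc[symmetric])

lemma transpose_eq_iff: "transpose A = A \<longleftrightarrow> (\<forall>i j. A $ i $ j = A $ j $ i)"
  by (auto simp: transpose_def vec_eq_iff)

lemma inner_symmetric_matrix:
  fixes A :: "real^'n^'n"
  assumes "transpose A = A"
  shows "x \<bullet> (A *v y) = (A *v x) \<bullet> y"
  using dot_lmul_matrix[of x A y] transpose_matrix_vector[of A x] assms by simp

definition spd :: "real^'n^'n \<Rightarrow> bool" where
  "spd A \<longleftrightarrow> transpose A = A \<and> (\<forall>x. x \<noteq> 0 \<longrightarrow> x \<bullet> (A *v x) > 0)"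

context
  fixes g :: "real^'n^'n"
  assumes spd: "spd g"
begin

lemma spd_invertible: "invertible g"
  using spd unfolding spd_def invertible_left_inverse matrix_left_invertible_ker
  by (metis inner_zero_right less_irrefl)

lemma spd_inv_left: "matrix_inv g ** g = mat 1"
  and spd_inv_right: "g ** matrix_inv g = mat 1"
  using someI_ex[OF spd_invertible[unfolded invertible_def]]
  by (auto simp: matrix_inv_def)

lemma spd_inv_vec: "matrix_inv g *v (g *v x) = x" "g *v (matrix_inv g *v x) = x"
  by (simp_all add: matrix_vector_mul_assoc spd_inv_left spd_inv_right)

lemma spd_inv_symmetric: "transpose (matrix_inv g) = matrix_inv g"
proof -
  have "transpose (matrix_inv g) = transpose (matrix_inv g) ** (g ** matrix_inv g)"
    by (simp add: spd_inv_right)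
  also have "\<dots> = transpose (transpose g ** matrix_inv g) ** matrix_inv g"
    by (simp add: matrix_mul_assoc matrix_transpose_mul)
  also have "\<dots> = matrix_inv g"
    using spd by (simp add: spd_def spd_inv_right)
  finally show ?thesis .
qed

lemma spd_quadratic_form_nonneg: "x \<bullet> (g *v x) \<ge> 0"
  using spd unfolding spd_def by (cases "x = 0") (auto simp: less_imp_le)

lemma spd_quadratic_form_inv: "(g *v x) \<bullet> (matrix_inv g *v (g *v x)) = x \<bullet> (g *v x)"
  by (simp add: spd_inv_vec inner_commute)

lemma spd_inv: "spd (matrix_inv g)"
  unfolding spd_def
proof (intro conjI allI impI)
  fix x :: "real^'n" assume "x \<noteq> 0"
  then have "matrix_inv g *v x \<noteq> 0"
    using spd_inv_vec(2)[of x] by auto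
  then show "x \<bullet> (matrix_inv g *v x) > 0"
    using spd by (metis inner_commute spd_def spd_inv_vec(2)[of x])
qed (rule spd_inv_symmetric)

end

text \<open>The upper triangular factor is written down explicitly. Each pivot is positive because
  it is the value of the quadratic form at a vector whose earlier coordinates annihilate the
  preceding squares.\<close>

lemma spd_cholesky:
  fixes g :: "real^3^3"
  assumes "spd g"
  obtains A :: "real^3^3" where "g = transpose A ** A"
proof -
  have sym: "g$2$1 = g$1$2" "g$3$1 = g$1$3" "g$3$2 = g$2$3"
    using assms by (auto simp: spd_def transpose_eq_iff)
  have pos: "x \<bullet> (g *v x) > 0" if "x \<noteq> 0" for x
    using assms that by (simp add: spd_def)
  have form: "x \<bullet> (g *v x) = g$1$1 * (x$1)\<^sup>2 + g$2$2 * (x$2)\<^sup>2 + g$3$3 * (x$3)\<^sup>2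
      + 2 * g$1$2 * x$1 * x$2 + 2 * g$1$3 * x$1 * x$3 + 2 * g$2$3 * x$2 * x$3" for x
    by (simp add: inner_vec_def matrix_vector_mult_def sum_3 sym power2_eq_square algebra_simps)
  define a where "a = sqrt (g$1$1)"
  have "g$1$1 > 0"
    using pos[of "vector [1, 0, 0]"] by (simp add: form vec_eq_iff forall_3)
  then have a: "a > 0" "a\<^sup>2 = g$1$1" by (auto simp: a_def)
  define b where "b = g$1$2 / a"
  define c where "c = g$1$3 / a"
  have bc: "a * b = g$1$2" "a * c = g$1$3" using a by (auto simp: b_def c_def)
  define d where "d = sqrt (g$2$2 - b\<^sup>2)"
  \<comment> \<open>The test vector makes the first square \<open>(a * x + b * y + c * z)^2\<close>
    vanish, so the form equals the second pivot.\<close>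
  have "g$2$2 - b\<^sup>2 > 0"
    using pos[of "vector [- b / a, 1, 0]"] a(1)
    by (simp add: form vec_eq_iff forall_3 a(2)[symmetric] bc[symmetric] power_divide)
      (simp add: field_simps power2_eq_square)
  then have d: "d > 0" "d\<^sup>2 + b\<^sup>2 = g$2$2" by (auto simp: d_def)
  define e where "e = (g$2$3 - b * c) / d"
  have e: "d * e + b * c = g$2$3" using d by (auto simp: e_def)
  define l where "l = sqrt (g$3$3 - c\<^sup>2 - e\<^sup>2)"
  have "g$3$3 - c\<^sup>2 - e\<^sup>2 > 0"
  proof -
    \<comment> \<open>Back substitution: \<open>x\<close> and \<open>y\<close> annihilate the first
      two squares at third coordinate 1, leaving the last pivot.\<close>
    define y where "y = - e / d"
    define x where "x = - (c + b * y) / a"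
    have y: "d * y = - e" and x: "a * x = - (c + b * y)"
      using a d by (auto simp: x_def y_def)
    have "0 < (a * x + b * y + c)\<^sup>2 + (d * y + e)\<^sup>2 + (g$3$3 - c\<^sup>2 - e\<^sup>2)"
      using pos[of "vector [x, y, 1]"]
      by (simp add: form vec_eq_iff forall_3 a(2)[symmetric] bc[symmetric] d(2)[symmetric] e[symmetric])
        (simp add: algebra_simps power2_eq_square)
    then show ?thesis by (simp add: x y)
  qed
  then have l: "l\<^sup>2 + c\<^sup>2 + e\<^sup>2 = g$3$3" by (simp add: l_def)
  define A :: "real^3^3" where
    "A = vector [vector [a, b, c], vector [0, d, e], vector [0, 0, l]]"
  have "g = transpose A ** A"
    using a bc d e l sym
    by (simp add: vec_eq_iff forall_3 A_def transpose_def matrix_matrix_mult_def sum_3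
        power2_eq_square algebra_simps)
  then show thesis by (rule that)
qed

lemma spd_det_nonneg: "det g \<ge> 0" if "spd g" for g :: "real^3^3"
  using spd_cholesky[OF that] by (metis det_mul det_transpose zero_le_square)

text \<open>Writing the inverse metric as \<open>transpose A ** A\<close> and using cyclicity of the
  trace turns \<open>ksq g \<tau>\<close> into the trace of the square of the symmetric matrix
  \<open>N\<close>, a sum of squares of entries.\<close>

lemma ksq_nonneg:
  assumes "spd g" "transpose \<tau> = \<tau>"
  shows "ksq g \<tau> \<ge> 0"
proof -
  obtain A :: mat3 where A: "matrix_inv g = transpose A ** A"
    using spd_cholesky[OF spd_inv[OF assms(1)]] .
  define N where "N = A ** \<tau> ** transpose A"
  have "transpose N = N"
    by (simp add: N_def matrix_transpose_mul assms matrix_mul_assoc)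
  have "ksq g \<tau> = trace (transpose A ** (A ** \<tau> ** transpose A ** A ** \<tau>))"
    by (simp add: ksq_def A matrix_mul_assoc)
  also have "\<dots> = trace (N ** N)"
    by (subst trace_mul_sym) (simp add: N_def matrix_mul_assoc)
  also have "\<dots> = (\<Sum>i\<in>UNIV. \<Sum>j\<in>UNIV. (N $ i $ j)\<^sup>2)"
    using \<open>transpose N = N\<close>
    by (simp add: trace_def matrix_matrix_mult_def transpose_eq_iff power2_eq_square)
  also have "\<dots> \<ge> 0" by (intro sum_nonneg) auto
  finally show ?thesis .
qed

lemma trace_mult_outer:
  "trace (N ** (\<chi> i j. y $ i * y $ j)) = y \<bullet> (N *v y)" for N :: "real^'n^'n"
  by (simp add: trace_def matrix_matrix_mult_def inner_vec_def matrix_vector_mult_def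
      sum_distrib_left mult_ac)

text \<open>Cauchy--Schwarz between \<open>\<tau>\<close> and the rank-one matrix \<open>y y\<^sup>T\<close>, \<open>y = g x\<close>, for the inner
  product on symmetric matrices whose square is \<^const>\<open>ksq\<close>.\<close>

lemma quadratic_form_le_ksq:
  fixes g \<tau> :: mat3
  assumes g: "spd g" and \<tau>: "transpose \<tau> = \<tau>"
  shows "\<bar>x \<bullet> (\<tau> *v x)\<bar> \<le> sqrt (ksq g \<tau>) * (x \<bullet> (g *v x))"
proof (cases "x = 0")
  case False
  define y where "y = g *v x"
  define X :: mat3 where "X = (\<chi> i j. y $ i * y $ j)"
  define M where "M = matrix_inv g"
  define b where "b = x \<bullet> (\<tau> *v x)"
  define c where "c = x \<bullet> (g *v x)"
  have c: "c > 0" using g False by (simp add: spd_def c_def)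
  have My: "M *v y = x"
    by (simp add: M_def y_def spd_inv_vec[OF g])
  have sM: "transpose M = M"
    by (simp add: M_def spd_inv_symmetric[OF g])
  have tX: "transpose X = X" by (simp add: X_def transpose_eq_iff)
  have XMX: "X ** M ** X = c *\<^sub>R X"
  proof -
    have "c = y \<bullet> (M *v y)" unfolding My by (simp add: c_def y_def inner_commute)
    then show ?thesis
      by (simp add: vec_eq_iff X_def matrix_matrix_mult_def inner_vec_def matrix_vector_mult_def
        sum_3 algebra_simps)
  qed
  have t1: "trace (M ** \<tau> ** M ** X) = b"
    by (simp add: X_def trace_mult_outer inner_symmetric_matrix[OF sM] My b_def
        flip: matrix_vector_mul_assoc)
  have t2: "trace (M ** X ** M ** X) = c\<^sup>2"
  proof -
    have "trace (M ** X ** M ** X) = trace (M ** (c *\<^sub>R X))"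
      by (simp add: matrix_mul_assoc flip: XMX)
    also have "\<dots> = c * (y \<bullet> (M *v y))"
      by (simp add: bounded_bilinear.scaleR_right[OF bounded_bilinear_matrix_mult]
          linear_cmul[OF bounded_linear.linear[OF bounded_linear_trace]] trace_mult_outer X_def)
    finally show ?thesis unfolding My by (simp add: c_def y_def inner_commute power2_eq_square)
  qed
  have t3: "trace (M ** X ** M ** \<tau>) = b"
    using trace_mul_sym[of "M ** X" "M ** \<tau>"] t1 by (simp add: matrix_mul_assoc)
  \<comment> \<open>Subtracting the orthogonal projection of \<open>\<tau>\<close> onto
    \<open>X\<close>: their inner product is \<open>b\<close> and the square of \<open>X\<close> is
    \<open>c^2\<close>, so \<open>b / c^2\<close> is the minimising coefficient.\<close>
  have "0 \<le> ksq g (\<tau> - (b / c\<^sup>2) *\<^sub>R X)"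
    by (rule ksq_nonneg[OF g])
      (use \<tau> tX in \<open>simp add: transpose_eq_iff\<close>)
  also have "\<dots> = ksq g \<tau> - 2 * (b / c\<^sup>2) * b + (b / c\<^sup>2)\<^sup>2 * c\<^sup>2"
    using t1 t2 t3 unfolding ksq_def M_def[symmetric]
    by (simp add: bounded_bilinear.diff_right[OF bounded_bilinear_matrix_mult]
        bounded_bilinear.diff_left[OF bounded_bilinear_matrix_mult]
        bounded_bilinear.scaleR_right[OF bounded_bilinear_matrix_mult]
        bounded_bilinear.scaleR_left[OF bounded_bilinear_matrix_mult] trace_sub
        linear_cmul[OF bounded_linear.linear[OF bounded_linear_trace]] power2_eq_square)
  also have "\<dots> = ksq g \<tau> - b\<^sup>2 / c\<^sup>2"
    using c by (simp add: field_simps power2_eq_square)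
  finally have "b\<^sup>2 \<le> ksq g \<tau> * c\<^sup>2"
    using c by (simp add: field_simps)
  then have "sqrt (b\<^sup>2) \<le> sqrt (ksq g \<tau> * c\<^sup>2)" by (rule real_sqrt_le_mono)
  then show ?thesis using c by (simp add: real_sqrt_mult b_def c_def)
qed simp

section \<open>Derivative of the inverse metric\<close>

text \<open>Cramer's rule expresses the entries of the inverse as quotients of polynomials in the
  entries of \<open>g\<close>. The formula is available on \<open>I\<close> only, and openness of
  \<open>I\<close> transfers differentiability at \<open>t\<close>.\<close>

lemma differentiable_matrix_inv:
  fixes g :: "real \<Rightarrow> real^3^3"
  assumes "open I" "t \<in> I" and inv: "\<And>s. s \<in> I \<Longrightarrow> det (g s) \<noteq> 0 \<and> g s ** matrix_inv (g s) = mat 1"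
    and diff: "g differentiable (at t)"
  shows "(\<lambda>s. matrix_inv (g s)) differentiable (at t)"
proof -
  have comp: "(\<lambda>s. g s $ a $ b) differentiable (at t)" for a b
  proof -
    obtain D where "(g has_derivative D) (at t)"
      using diff by (auto simp: differentiable_def)
    then have "((\<lambda>s. g s $ a $ b) has_derivative (\<lambda>x. D x $ a $ b)) (at t)"
      by (intro bounded_linear.has_derivative[OF bounded_linear_vec_nth])
    then show ?thesis by (auto simp: differentiable_def)
  qed
  \<comment> \<open>Cramer numerator for the entry \<open>(i, j)\<close> of the inverse: column
    \<open>i\<close> of \<open>g s\<close> is replaced by the \<open>j\<close>-th basis
    vector.\<close>
  define N where "N s i j = det (\<chi> a b. if b = i then (axis j 1 :: real^3) $ a else g s $ a $ b)" for s i j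
  have N: "(\<lambda>s. N s i j) differentiable (at t)" for i j
  proof -
    have "(\<lambda>s. if b = i then (axis j 1 :: real^3) $ a else g s $ a $ b) differentiable (at t)" for a b
      using comp by (cases "b = i") auto
    then show ?thesis
      unfolding N_def det_3 vec_lambda_beta
      by (intro differentiable_add differentiable_diff differentiable_mult)
  qed
  have d: "(\<lambda>s. det (g s)) differentiable (at t)"
    unfolding det_3 by (intro differentiable_add differentiable_diff differentiable_mult comp)
  have eq: "matrix_inv (g s) $ i $ j = N s i j / det (g s)" if "s \<in> I" for s i j
  proof -
    have "g s *v (matrix_inv (g s) *v axis j 1) = axis j 1"
      using inv[OF that] by (simp add: matrix_vector_mul_assoc)
    then have "(matrix_inv (g s) *v axis j 1) $ i = N s i j / det (g s)"
      using cramer[of "g s" "matrix_inv (g s) *v axis j 1" "axis j 1"] inv[OF that]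
      by (simp add: N_def)
    then show ?thesis
      by (simp add: matrix_vector_mult_basis column_def)
  qed
  have "(\<lambda>s. matrix_inv (g s) $ i $ j) differentiable (at t)" for i j
  proof -
    have "(\<lambda>s. N s i j / det (g s)) differentiable (at t)"
      using N d inv[OF \<open>t \<in> I\<close>] by (intro differentiable_divide) auto
    then show ?thesis
      unfolding differentiable_def
      using has_derivative_transform_within_open[OF _ \<open>open I\<close> \<open>t \<in> I\<close>] eq by (metis (no_types, lifting))
  qed
  then show ?thesis
    by (subst differentiable_componentwise_within)
      (auto simp: Basis_vec_def inner_axis)
qed

text \<open>With differentiability known, the formula follows by differentiating the constant
  product of \<open>g\<close> and its inverse.\<close>

lemma has_vector_derivative_matrix_inv:
  fixes g :: "real \<Rightarrow> real^3^3"
  assumes "open I" "t \<in> I" and spd: "\<And>s. s \<in> I \<Longrightarrow> spd (g s)"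
    and g': "(g has_vector_derivative g') (at t)"
  shows "((\<lambda>s. matrix_inv (g s)) has_vector_derivative
      - (matrix_inv (g t) ** g' ** matrix_inv (g t))) (at t)"
proof -
  have "(\<lambda>s. matrix_inv (g s)) differentiable (at t)"
  proof (rule differentiable_matrix_inv[OF assms(1,2)])
    show "g differentiable (at t)"
      using g' by (auto simp: has_vector_derivative_def differentiable_def)
  qed (use spd spd_invertible spd_inv_right in \<open>auto simp: invertible_det_nz\<close>)
  then obtain M' where M': "((\<lambda>s. matrix_inv (g s)) has_vector_derivative M') (at t)"
    by (auto simp: vector_derivative_works)
  have "((\<lambda>s. g s ** matrix_inv (g s)) has_vector_derivative
      g t ** M' + g' ** matrix_inv (g t)) (at t)"
    by (rule bounded_bilinear.has_vector_derivative[OF bounded_bilinear_matrix_mult g' M'])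
  moreover have "((\<lambda>s. g s ** matrix_inv (g s)) has_vector_derivative 0) (at t)"
    by (rule has_vector_derivative_transform_within_open[OF has_vector_derivative_const assms(1,2)])
      (simp add: spd_inv_right[OF spd])
  ultimately have "g t ** M' + g' ** matrix_inv (g t) = 0"
    by (rule vector_derivative_unique_at)
  then have "matrix_inv (g t) ** (g t ** M') = matrix_inv (g t) ** - (g' ** matrix_inv (g t))"
    by (simp add: add_eq_0_iff2)
  then have "M' = - (matrix_inv (g t) ** g' ** matrix_inv (g t))"
    using spd_inv_left[OF spd[OF \<open>t \<in> I\<close>]]
    by (simp add: matrix_mul_assoc bounded_bilinear.minus_right[OF bounded_bilinear_matrix_mult])
  with M' show ?thesis by simp
qed

section \<open>The energy-momentum tensor\<close>

lemma integrable_bounded_support: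
  fixes \<phi> :: "'a::euclidean_space \<Rightarrow> real"
  assumes "continuous_on UNIV \<phi>" "\<And>p. \<phi> p \<noteq> 0 \<Longrightarrow> norm p \<le> r"
  shows "integrable lborel \<phi>"
proof -
  have "integrable lborel (\<lambda>p. indicator (cball 0 r) p *\<^sub>R \<phi> p)"
    using assms(1) by (intro borel_integrable_compact) (auto intro: continuous_on_subset)
  moreover have "(\<lambda>p. indicator (cball 0 r) p *\<^sub>R \<phi> p) = \<phi>"
    using assms(2) by (auto simp: indicator_def fun_eq_iff)
  ultimately show ?thesis by simp
qed

text \<open>The matter at one instant. Continuity and the bound \<open>b\<close> on the support make
  every moment of \<open>fp\<close> integrable.\<close>

locale matter =
  fixes m :: real and g :: mat3 and fp :: "vec3 \<Rightarrow> real" and b :: real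
  assumes m_pos: "m > 0" and spd_g: "spd g" and nonneg: "fp p \<ge> 0"
    and cont: "continuous_on UNIV fp"
    and bounded_support: "fp p \<noteq> 0 \<Longrightarrow> norm p \<le> b"
begin

lemma energy_pos: "energy m g p > 0"
  using m_pos spd_quadratic_form_nonneg[OF spd_g, of p]
  by (simp add: energy_def add_pos_nonneg)

lemma cont_matrix_vector: "continuous_on S (\<lambda>p. A *v p)" for A :: mat3
  by (intro linear_continuous_on matrix_vector_mul_bounded_linear)

lemma cont_energy: "continuous_on UNIV (energy m g)"
  unfolding energy_def by (intro continuous_intros cont_matrix_vector)

lemma integrable_mult:
  assumes "continuous_on UNIV \<phi>"
  shows "integrable lborel (\<lambda>p. fp p * \<phi> p)"
  by (rule integrable_bounded_support[where r = b])
    (auto intro!: continuous_intros assms cont bounded_support)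

text \<open>Integrability of each moment permits exchanging the finite sums with the integral.
  Estimates on traces of \<open>Smat\<close> thereby reduce to pointwise estimates on quadratic
  forms.\<close>

lemma trace_Smat:
  "trace (N ** Smat m g fp) =
    (\<integral>p. fp p * (((g *v p) \<bullet> (N *v (g *v p))) / energy m g p * sqrt (det g)) \<partial>lborel)"
proof -
  let ?y = "\<lambda>p. g *v p" and ?w = "\<lambda>p. sqrt (det g) / energy m g p"
  have int: "integrable lborel (\<lambda>p. fp p * (?y p $ j * ?y p $ i * ?w p))" for i j
    using energy_pos
    by (intro integrable_mult continuous_intros cont_matrix_vector cont_energy) (auto simp: less_le)
  have S: "Smat m g fp $ j $ i = (\<integral>p. fp p * (?y p $ j * ?y p $ i * ?w p) \<partial>lborel)" for i j
    by (simp add: Smat_def mult_ac)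
  have "trace (N ** Smat m g fp) = (\<Sum>i\<in>UNIV. \<Sum>j\<in>UNIV. N $ i $ j * Smat m g fp $ j $ i)"
    by (simp add: trace_def matrix_matrix_mult_def)
  also have "\<dots> = (\<Sum>i\<in>UNIV. \<Sum>j\<in>UNIV. (\<integral>p. N $ i $ j * (fp p * (?y p $ j * ?y p $ i * ?w p)) \<partial>lborel))"
    unfolding S integral_mult_right_zero ..
  also have "\<dots> = (\<Sum>i\<in>UNIV. (\<integral>p. (\<Sum>j\<in>UNIV. N $ i $ j * (fp p * (?y p $ j * ?y p $ i * ?w p))) \<partial>lborel))"
    by (intro sum.cong refl Bochner_Integration.integral_sum[symmetric] integrable_mult_right int)
  also have "\<dots> = (\<integral>p. (\<Sum>i\<in>UNIV. \<Sum>j\<in>UNIV. N $ i $ j * (fp p * (?y p $ j * ?y p $ i * ?w p))) \<partial>lborel)"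
    by (intro Bochner_Integration.integral_sum[symmetric] Bochner_Integration.integrable_sum
        integrable_mult_right int)
  also have "\<dots> = (\<integral>p. fp p * ((?y p \<bullet> (N *v ?y p)) / energy m g p * sqrt (det g)) \<partial>lborel)"
    by (intro Bochner_Integration.integral_cong refl)
      (simp add: inner_vec_def matrix_vector_mult_def sum_3 algebra_simps add_divide_distrib)
  finally show ?thesis .
qed

lemma trace_inv_Smat:
  "trace (matrix_inv g ** Smat m g fp) =
    (\<integral>p. fp p * ((p \<bullet> (g *v p)) / energy m g p * sqrt (det g)) \<partial>lborel)"
  by (simp add: trace_Smat spd_quadratic_form_inv[OF spd_g])

lemma cont_form: "continuous_on UNIV (\<lambda>p. p \<bullet> (A *v p) / energy m g p * sqrt (det g))" for A
  using energy_pos by (intro continuous_intros cont_matrix_vector cont_energy) (auto simp: less_le)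

lemma trace_inv_Smat_nonneg: "trace (matrix_inv g ** Smat m g fp) \<ge> 0"
  unfolding trace_inv_Smat
  using nonneg energy_pos spd_quadratic_form_nonneg[OF spd_g] spd_det_nonneg[OF spd_g]
  by (intro Bochner_Integration.integral_nonneg mult_nonneg_nonneg divide_nonneg_pos) auto

text \<open>Pointwise, with \<open>v = p \<bullet> (g *v p) \<le> r\<close> and
  \<open>E^2 \<ge> m^2\<close>, one has \<open>v / E \<le> r / m^2 * E\<close>. Positive mass enters
  here: for slow particles the pressure is small against the density.\<close>

lemma trace_inv_Smat_le_rho:
  assumes "\<And>p. fp p \<noteq> 0 \<Longrightarrow> p \<bullet> (g *v p) \<le> r"
  shows "trace (matrix_inv g ** Smat m g fp) \<le> r / m\<^sup>2 * rho m g fp"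
proof -
  have "trace (matrix_inv g ** Smat m g fp)
      \<le> (\<integral>p. r / m\<^sup>2 * (fp p * (energy m g p * sqrt (det g))) \<partial>lborel)"
    unfolding trace_inv_Smat
  proof (intro integral_mono integrable_mult cont_form integrable_mult_right)
    show "continuous_on UNIV (\<lambda>p. energy m g p * sqrt (det g))"
      by (intro continuous_intros cont_energy)
    fix p
    show "fp p * (p \<bullet> (g *v p) / energy m g p * sqrt (det g))
        \<le> r / m\<^sup>2 * (fp p * (energy m g p * sqrt (det g)))"
    proof (cases "fp p = 0")
      case False
      let ?v = "p \<bullet> (g *v p)" and ?E = "energy m g p"
      have v: "?v \<ge> 0" using spd_quadratic_form_nonneg[OF spd_g] .
      then have "m\<^sup>2 \<le> ?E\<^sup>2" by (simp add: energy_def)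
      then have "?v * m\<^sup>2 \<le> r * ?E\<^sup>2"
        using assms[OF False] v by (intro mult_mono) auto
      then have "?v / ?E \<le> r / m\<^sup>2 * ?E"
        using m_pos energy_pos[of p] by (simp add: field_simps power2_eq_square)
      then have "fp p * (?v / ?E * sqrt (det g)) \<le> fp p * (r / m\<^sup>2 * ?E * sqrt (det g))"
        using nonneg spd_det_nonneg[OF spd_g] by (intro mult_left_mono mult_right_mono) auto
      then show ?thesis by (simp add: mult_ac)
    qed simp
  qed
  then show ?thesis by (simp add: rho_def mult.assoc)
qed

text \<open>\<open>quadratic_form_le_ksq\<close> is applied under the integral for each momentum,
  and the constant is pulled out.\<close>

lemma shear_stress_le:
  assumes "transpose \<tau> = \<tau>"
  shows "\<bar>trace (matrix_inv g ** \<tau> ** matrix_inv g ** Smat m g fp)\<bar>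
    \<le> sqrt (ksq g \<tau>) * trace (matrix_inv g ** Smat m g fp)"
proof -
  let ?M = "matrix_inv g"
  have y: "(g *v p) \<bullet> ((?M ** \<tau> ** ?M) *v (g *v p)) = p \<bullet> (\<tau> *v p)" for p
    using inner_symmetric_matrix[OF spd_inv_symmetric[OF spd_g], of "g *v p" "\<tau> *v p"]
    by (simp add: spd_inv_vec[OF spd_g] flip: matrix_vector_mul_assoc)
  have "\<bar>trace (?M ** \<tau> ** ?M ** Smat m g fp)\<bar>
      \<le> (\<integral>p. \<bar>fp p * (p \<bullet> (\<tau> *v p) / energy m g p * sqrt (det g))\<bar> \<partial>lborel)"
    unfolding trace_Smat y by (rule integral_abs_bound)
  also have "\<dots> \<le> (\<integral>p. sqrt (ksq g \<tau>) * (fp p * (p \<bullet> (g *v p) / energy m g p * sqrt (det g))) \<partial>lborel)"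
  proof (intro integral_mono integrable_abs integrable_mult cont_form integrable_mult_right)
    fix p
    have "fp p / energy m g p * sqrt (det g) * \<bar>p \<bullet> (\<tau> *v p)\<bar>
        \<le> fp p / energy m g p * sqrt (det g) * (sqrt (ksq g \<tau>) * (p \<bullet> (g *v p)))"
      using quadratic_form_le_ksq[OF spd_g assms] nonneg[of p] energy_pos[of p] spd_det_nonneg[OF spd_g]
      by (intro mult_left_mono) auto
    then show "\<bar>fp p * (p \<bullet> (\<tau> *v p) / energy m g p * sqrt (det g))\<bar>
        \<le> sqrt (ksq g \<tau>) * (fp p * (p \<bullet> (g *v p) / energy m g p * sqrt (det g)))"
      using nonneg[of p] energy_pos[of p] spd_det_nonneg[OF spd_g]
      by (simp add: abs_mult mult_ac)
  qed
  also have "\<dots> = sqrt (ksq g \<tau>) * trace (?M ** Smat m g fp)"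
    unfolding trace_inv_Smat by (rule integral_mult_right_zero)
  finally show ?thesis .
qed

end

section \<open>Solutions of the Einstein--Vlasov system\<close>

locale bianchi_I_solution =
  fixes m :: real and I :: "real set" and g k :: "real \<Rightarrow> mat3" and f :: "real \<Rightarrow> vec3 \<Rightarrow> real"
    and t0 :: real
  assumes m_pos: "m > 0" and I: "open I" "is_interval I" "{t0..} \<subseteq> I"
    and sol: "EV_solution m I g k f"
    and H_neg: "t \<in> I \<Longrightarrow> mean_curv (g t) (k t) < 0"
begin

abbreviation "M t \<equiv> matrix_inv (g t)"
abbreviation "H t \<equiv> mean_curv (g t) (k t)"
abbreviation "S t \<equiv> Smat m (g t) (f t)"
abbreviation "trS t \<equiv> trace (M t ** S t)"
abbreviation "\<rho> t \<equiv> rho m (g t) (f t)"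
abbreviation "\<sigma> t \<equiv> sigma (g t) (k t)"
abbreviation "F t \<equiv> Fshear (g t) (k t)"

lemma t_in_I: "t0 \<le> t \<Longrightarrow> t \<in> I" using I by auto

lemma spd_g: "t \<in> I \<Longrightarrow> spd (g t)"
  and k_symmetric: "t \<in> I \<Longrightarrow> transpose (k t) = k t"
  and f_nonneg: "t \<in> I \<Longrightarrow> f t p \<ge> 0"
  and g_deriv: "t \<in> I \<Longrightarrow> (g has_vector_derivative (- 2 *\<^sub>R k t)) (at t)"
  and k_deriv: "t \<in> I \<Longrightarrow> (k has_vector_derivative
          (H t *\<^sub>R k t - 2 *\<^sub>R (k t ** M t ** k t)
           - (8 * pi) *\<^sub>R (S t - (1/2 * trS t) *\<^sub>R g t) - (4 * pi * \<rho> t) *\<^sub>R g t)) (at t)"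
  and constraint: "t \<in> I \<Longrightarrow> - ksq (g t) (k t) + (H t)\<^sup>2 = 16 * pi * \<rho> t"
  and vlasov: "t \<in> I \<Longrightarrow> \<exists>D. ((\<lambda>(s,q). f s q) has_derivative D) (at (t,p)) \<and>
                     D (1, 2 *\<^sub>R ((M t ** k t) *v p)) = 0"
  using sol unfolding EV_solution_def spd_def by auto

section \<open>Evolution of the mean curvature and the shear\<close>

lemma M_deriv: "(M has_vector_derivative 2 *\<^sub>R (M t ** k t ** M t)) (at t)" if "t \<in> I"
  using has_vector_derivative_matrix_inv[OF I(1) that spd_g g_deriv[OF that]]
  by (simp add: matrix_mult_simps bounded_bilinear.minus_right[OF bounded_bilinear_matrix_mult]
      bounded_bilinear.minus_left[OF bounded_bilinear_matrix_mult])

text \<open>With one index raised, the derivative of the inverse metric cancels the quadratic term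
  of the evolution equation, leaving an equation linear in \<open>M t ** k t\<close> apart from the
  factor \<open>H t\<close>.\<close>

lemma mixed_deriv: "((\<lambda>t. M t ** k t) has_vector_derivative
    (H t *\<^sub>R (M t ** k t) - (8 * pi) *\<^sub>R (M t ** S t) + (4 * pi * (trS t - \<rho> t)) *\<^sub>R mat 1)) (at t)"
  if "t \<in> I"
proof -
  have "((\<lambda>t. M t ** k t) has_vector_derivative
    (M t ** (H t *\<^sub>R k t - 2 *\<^sub>R (k t ** M t ** k t)
           - (8 * pi) *\<^sub>R (S t - (1/2 * trS t) *\<^sub>R g t) - (4 * pi * \<rho> t) *\<^sub>R g t)
       + (2 *\<^sub>R (M t ** k t ** M t)) ** k t)) (at t)"
    by (rule matrix_mult_derivative[OF M_deriv k_deriv]) (rule that)+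
  then show ?thesis
    by (rule has_vector_derivative_eq_rhs)
      (simp add: matrix_mult_simps spd_inv_left[OF spd_g[OF that]] matrix_mul_assoc algebra_simps)
qed

lemma ksq_sigma: "ksq (g t) (\<sigma> t) = ksq (g t) (k t) - (H t)\<^sup>2 / 3" if "t \<in> I"
proof -
  have "M t ** \<sigma> t = M t ** k t - (H t / 3) *\<^sub>R mat 1"
    by (simp add: sigma_def matrix_mult_simps spd_inv_left[OF spd_g[OF that]])
  then have "ksq (g t) (\<sigma> t) = trace ((M t ** k t - (H t / 3) *\<^sub>R mat 1) ** (M t ** k t - (H t / 3) *\<^sub>R mat 1))"
    by (simp add: ksq_def flip: matrix_mul_assoc)
  also have "\<dots> = ksq (g t) (k t) - 2 * H t / 3 * H t + (H t / 3)\<^sup>2 * 3"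
    by (simp add: matrix_mult_simps ksq_def mean_curv_def trace_I matrix_mul_assoc power2_eq_square)
  finally show ?thesis by (simp add: power2_eq_square field_simps)
qed

lemma F_eq: "F t = ksq (g t) (k t) / (H t)\<^sup>2 - 1/3" if "t \<in> I"
  using H_neg[OF that] by (simp add: Fshear_def ksq_sigma[OF that] field_simps)

lemma sigma_symmetric: "transpose (\<sigma> t) = \<sigma> t" if "t \<in> I"
  using k_symmetric[OF that] spd_g[OF that] by (simp add: sigma_def spd_def transpose_eq_iff)

lemma F_nonneg: "F t \<ge> 0" if "t \<in> I"
  using ksq_nonneg[OF spd_g sigma_symmetric] that by (simp add: Fshear_def)

lemma sqrt_ksq_sigma: "sqrt (ksq (g t) (\<sigma> t)) = - H t * sqrt (F t)" if "t \<in> I"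
  using H_neg[OF that] by (simp add: Fshear_def real_sqrt_divide)

text \<open>The constraint eliminates the density in favour of \<open>H\<close> and
  \<open>F\<close>; this closes the scalar system up to the stress terms.\<close>

lemma rho_eq: "4 * pi * \<rho> t = (H t)\<^sup>2 * (1/6 - F t / 4)" if "t \<in> I"
proof -
  have "ksq (g t) (k t) = (H t)\<^sup>2 - 16 * pi * \<rho> t"
    using constraint[OF that] by simp
  then have "F t = 2/3 - 16 * pi * \<rho> t / (H t)\<^sup>2"
    using H_neg[OF that] by (simp add: F_eq[OF that] diff_divide_distrib)
  then show ?thesis
    using H_neg[OF that] by (simp add: field_simps)
qed

lemma trace_k_S: "trace (M t ** k t ** M t ** S t) = trace (M t ** \<sigma> t ** M t ** S t) + H t / 3 * trS t"
  if "t \<in> I"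
  by (simp add: sigma_def matrix_mult_simps spd_inv_left[OF spd_g[OF that]])

text \<open>The trace of \<open>mixed_deriv\<close> is
  \<open>H^2 + 4 * pi * trS - 12 * pi * \<rho>\<close>, and \<open>rho_eq\<close> removes the
  density.\<close>

lemma H_deriv: "(H has_real_derivative (H t)\<^sup>2 * (1/2 + 3/4 * F t + 4 * pi * trS t / (H t)\<^sup>2)) (at t)"
  if "t \<in> I"
proof -
  have "(H has_real_derivative (H t)\<^sup>2 + 4 * pi * trS t - 3 * (4 * pi * \<rho> t)) (at t)"
    using trace_derivative[OF mixed_deriv[OF that]]
    unfolding mean_curv_def has_real_derivative_iff_has_vector_derivative
    by (simp add: matrix_mult_simps trace_I power2_eq_square algebra_simps)
  then show ?thesis
    by (rule DERIV_cong)
      (subst rho_eq[OF that], use H_neg[OF that] in \<open>simp add: field_simps\<close>)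
qed

lemma ksq_deriv: "((\<lambda>t. ksq (g t) (k t)) has_real_derivative
    2 * H t * ksq (g t) (k t) - 16 * pi * trace (M t ** k t ** M t ** S t)
      + 2 * (4 * pi * (trS t - \<rho> t)) * H t) (at t)"
  if "t \<in> I"
proof -
  have sym: "trace (M t ** S t ** M t ** k t) = trace (M t ** k t ** M t ** S t)"
    using trace_mul_sym[of "M t ** S t" "M t ** k t"] by (simp add: matrix_mul_assoc)
  let ?K = "\<lambda>t. M t ** k t"
  let ?K' = "H t *\<^sub>R ?K t - (8 * pi) *\<^sub>R (M t ** S t) + (4 * pi * (trS t - \<rho> t)) *\<^sub>R mat 1"
  have "((\<lambda>t. trace (?K t ** ?K t)) has_real_derivative trace (?K t ** ?K' + ?K' ** ?K t)) (at t)"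
    unfolding has_real_derivative_iff_has_vector_derivative
    by (intro trace_derivative matrix_mult_derivative mixed_deriv that)
  moreover have "trace (?K t ** ?K' + ?K' ** ?K t) =
      2 * H t * ksq (g t) (k t) - 16 * pi * trace (M t ** k t ** M t ** S t)
        + 2 * (4 * pi * (trS t - \<rho> t)) * H t"
    unfolding matrix_mult_simps
    by (simp add: matrix_mul_assoc sym ksq_def mean_curv_def)
  moreover have "trace (?K t ** ?K t) = ksq (g t) (k t)" for t
    by (simp add: ksq_def matrix_mul_assoc)
  ultimately show ?thesis by simp
qed

text \<open>The derivative of \<open>F\<close> after elimination of the density. The last term
  couples the shear to the stress tensor and is the source estimated by
  \<open>shear_stress_le\<close>.\<close>

definition "F' t = H t * F t * (1 - 3/2 * F t - 2 * (4 * pi * trS t / (H t)\<^sup>2))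
      - 16 * pi * trace (M t ** \<sigma> t ** M t ** S t) / (H t)\<^sup>2"

lemma F_deriv: "(F has_real_derivative F' t) (at t)" if "t \<in> I"
proof -
  let ?q = "ksq (g t) (k t)" and ?s = "4 * pi * trS t" and ?Z = "trace (M t ** \<sigma> t ** M t ** S t)"
  have H: "H t \<noteq> 0" using H_neg[OF that] by simp
  let ?q' = "2 * H t * ?q - 16 * pi * (?Z + H t / 3 * trS t) + 2 * (4 * pi * (trS t - \<rho> t)) * H t"
  let ?H' = "(H t)\<^sup>2 * (1/2 + 3/4 * F t + ?s / (H t)\<^sup>2)"
  have q: "?q = (F t + 1/3) * (H t)\<^sup>2" using H by (simp add: F_eq[OF that])
  have "((\<lambda>t. ksq (g t) (k t) / (H t)\<^sup>2 - 1/3) has_real_derivative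
      (?q' * (H t)\<^sup>2 - ?q * (2 * H t * ?H')) / ((H t)\<^sup>2 * (H t)\<^sup>2)) (at t)"
    using H by (auto intro!: derivative_eq_intros ksq_deriv H_deriv that simp: trace_k_S[OF that])
  moreover have "(?q' * (H t)\<^sup>2 - ?q * (2 * H t * ?H')) / ((H t)\<^sup>2 * (H t)\<^sup>2) = F' t"
  proof -
    have e: "2 * (4 * pi * (trS t - \<rho> t)) * H t = 2 * H t * ?s - 2 * H t * ((H t)\<^sup>2 * (1/6 - F t / 4))"
      unfolding rho_eq[OF that, symmetric] by (simp add: algebra_simps)
    have "?q' = 2 * H t * ((F t + 1/3) * (H t)\<^sup>2) - 16 * pi * ?Z + 2/3 * H t * ?s
        - 2 * H t * ((H t)\<^sup>2 * (1/6 - F t / 4))"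
      unfolding e q by (simp add: algebra_simps)
    \<comment> \<open>What remains is a rational identity, with \<open>x\<close>,
      \<open>\<phi>\<close>, \<open>s\<close>, \<open>z\<close> standing for \<open>H t\<close>,
      \<open>F t\<close>, \<open>?s\<close>, \<open>?Z\<close>.\<close>
    moreover have "((2 * x * ((\<phi> + 1/3) * x\<^sup>2) - 16 * pi * z + 2/3 * x * s - 2 * x * (x\<^sup>2 * (1/6 - \<phi> / 4))) * x\<^sup>2
          - (\<phi> + 1/3) * x\<^sup>2 * (2 * x * (x\<^sup>2 * (1/2 + 3/4 * \<phi> + s / x\<^sup>2)))) / (x\<^sup>2 * x\<^sup>2)
        = x * \<phi> * (1 - 3/2 * \<phi> - 2 * (s / x\<^sup>2)) - 16 * pi * z / x\<^sup>2"
      if "x \<noteq> 0" for x \<phi> s z :: real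
      using that by (simp add: divide_simps) (simp add: power2_eq_square power4_eq_xxxx algebra_simps)
    ultimately show ?thesis
      using H by (simp only: q F'_def)
  qed
  ultimately have "((\<lambda>t. ksq (g t) (k t) / (H t)\<^sup>2 - 1/3) has_real_derivative F' t) (at t)"
    by simp
  then show ?thesis
    by (rule has_field_derivative_transform_within_open[OF _ I(1) that]) (simp add: F_eq)
qed

section \<open>Characteristics and covariant momenta\<close>

text \<open>For fixed covariant \<open>q\<close>, the contravariant momentum \<open>M s *v q\<close>
  has derivative \<open>2 * (M s ** k s)\<close> applied to itself, which is the characteristic
  equation of the Vlasov equation. Hence \<open>f\<close> has zero derivative along this curve, and
  \<open>I\<close> is convex.\<close>

lemma f_transport:
  assumes "s \<in> I" "t \<in> I"
  shows "f s (M s *v q) = f t (M t *v q)"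
proof -
  have "((\<lambda>s. f s (M s *v q)) has_derivative (\<lambda>_. 0)) (at s within I)" if "s \<in> I" for s
  proof -
    define v where "v = 2 *\<^sub>R ((M s ** k s) *v (M s *v q))"
    obtain D where D: "((\<lambda>(s,q). f s q) has_derivative D) (at (s, M s *v q))" "D (1, v) = 0"
      using vlasov[OF \<open>s \<in> I\<close>] unfolding v_def by blast
    have "((\<lambda>s. M s *v q) has_vector_derivative v) (at s)"
      using bounded_linear.has_vector_derivative[OF bounded_linear_matrix_vector_left M_deriv[OF that]]
      by (simp add: v_def matrix_vector_mul_assoc scaleR_matrix_vector_assoc[symmetric])
    then have "((\<lambda>s. (s, M s *v q)) has_derivative (\<lambda>x. (x, x *\<^sub>R v))) (at s)"
      unfolding has_vector_derivative_def by (intro has_derivative_Pair has_derivative_ident)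
    then have "((\<lambda>s. (\<lambda>(s,q). f s q) (s, M s *v q)) has_derivative (\<lambda>x. D (x, x *\<^sub>R v))) (at s)"
      by (rule has_derivative_compose[where f = "\<lambda>s. (s, M s *v q)"]) (rule D(1))
    then have "((\<lambda>s. f s (M s *v q)) has_derivative (\<lambda>x. D (x, x *\<^sub>R v))) (at s)"
      by simp
    moreover have "D (x, x *\<^sub>R v) = 0" for x
      using linear_cmul[OF has_derivative_linear[OF D(1)], of x "(1, v)"] D(2) by simp
    ultimately show ?thesis by (simp add: has_derivative_at_withinI)
  qed
  moreover have "convex I" using I(2) is_interval_convex by blast
  ultimately obtain c where "\<forall>s\<in>I. f s (M s *v q) = c"
    using has_derivative_zero_constant[of I "\<lambda>s. f s (M s *v q)"] by auto
  then show ?thesis using assms by simp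
qed

text \<open>The support in covariant momenta. By \<open>f_transport\<close> it is the same at every
  time, with \<open>t0\<close> only as reference, so suprema over the support range over a fixed
  set.\<close>

definition "Q = {q. f t0 (M t0 *v q) \<noteq> 0}"

lemma f_nonzero_iff: "f t p \<noteq> 0 \<longleftrightarrow> g t *v p \<in> Q" if "t \<in> I"
  using f_transport[of t0 t "g t *v p"] that t_in_I[of t0]
  by (simp add: Q_def spd_inv_vec[OF spd_g])

abbreviation "V q t \<equiv> q \<bullet> (M t *v q)"

lemma V_deriv: "(V q has_real_derivative 2 * ((M t *v q) \<bullet> (k t *v (M t *v q)))) (at t)" if "t \<in> I"
proof -
  have "(V q has_real_derivative q \<bullet> ((2 *\<^sub>R (M t ** k t ** M t)) *v q)) (at t)"
    unfolding has_real_derivative_iff_has_vector_derivative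
    by (rule bounded_linear.has_vector_derivative[OF bounded_linear_quadratic_form M_deriv[OF that]])
  then show ?thesis
    by (simp add: scaleR_matrix_vector_assoc[symmetric] matrix_vector_mul_assoc[symmetric]
        inner_symmetric_matrix[OF spd_inv_symmetric[OF spd_g[OF that]]])
qed

text \<open>Splitting \<open>k\<close> into shear and trace, the trace part gives the exact rate
  \<open>2/3 * H\<close>, and \<open>quadratic_form_le_ksq\<close> bounds the shear part by
  \<open>- H * sqrt F\<close>, where \<open>- H\<close> is the absolute value of
  \<open>H\<close>.\<close>

lemma V'_le: "2 * ((M t *v q) \<bullet> (k t *v (M t *v q))) \<le> - 2 * (- H t) * (1/3 - sqrt (F t)) * V q t"
  if "t \<in> I"
proof -
  let ?p = "M t *v q"
  have k: "k t = \<sigma> t + (H t / 3) *\<^sub>R g t" by (simp add: sigma_def)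
  have V: "?p \<bullet> (g t *v ?p) = V q t"
    by (simp add: spd_inv_vec[OF spd_g[OF that]] inner_commute)
  have "?p \<bullet> (k t *v ?p) = ?p \<bullet> (\<sigma> t *v ?p) + H t / 3 * (?p \<bullet> (g t *v ?p))"
    by (subst k) (simp only: matrix_vector_mult_add_rdistrib inner_add_right
        scaleR_matrix_vector_assoc[symmetric] inner_scaleR_right)
  also have "?p \<bullet> (\<sigma> t *v ?p) \<le> - H t * sqrt (F t) * V q t"
    using quadratic_form_le_ksq[OF spd_g sigma_symmetric, OF that that, of ?p]
    by (simp add: sqrt_ksq_sigma[OF that] V)
  finally show ?thesis by (simp add: V algebra_simps)
qed

lemma Pmom_eq: "Pmom (g t) (f t) = (SUP q\<in>Q. ereal (sqrt (V q t)))" if "t \<in> I"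
proof -
  have "{p. f t p \<noteq> 0} = (\<lambda>q. M t *v q) ` Q"
    using f_nonzero_iff[OF that] spd_inv_vec[OF spd_g[OF that]]
    by (auto simp: image_iff) metis+
  then show ?thesis
    by (simp add: Pmom_def image_image spd_inv_vec[OF spd_g[OF that]])
qed

text \<open>The bound on \<open>V q t0\<close> confines the conserved covariant momenta to an
  ellipsoid, so the support stays bounded at each later or earlier time. Continuity of
  \<open>f t\<close> comes from the differentiability contained in the Vlasov equation.\<close>

lemma matter_at:
  assumes "t \<in> I" and Q: "\<And>q. q \<in> Q \<Longrightarrow> V q t0 \<le> r"
  obtains b where "matter m (g t) (f t) b"
proof -
  have t0: "t0 \<in> I" using t_in_I by simp
  obtain A :: mat3 where A: "M t0 = transpose A ** A"
    using spd_cholesky[OF spd_inv[OF spd_g[OF t0]]] .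
  have "invertible A"
    using spd_invertible[OF spd_inv[OF spd_g[OF t0]]] unfolding invertible_left_inverse A matrix_mul_assoc
    by metis
  then obtain A' where A': "A' ** A = mat 1" unfolding invertible_left_inverse by blast
  \<comment> \<open>For \<open>p\<close> in the support and \<open>q = g t *v p\<close>, one has
    \<open>p = (M t ** A') *v (A *v q)\<close>, and the norm of \<open>A *v q\<close> is the square
    root of \<open>V q t0\<close>.\<close>
  define b where "b = onorm ((*v) (M t ** A')) * sqrt r"
  have "norm p \<le> b" if "f t p \<noteq> 0" for p
  proof -
    define q where "q = g t *v p"
    have "q \<in> Q" using f_nonzero_iff[OF \<open>t \<in> I\<close>] that by (simp add: q_def)
    have "(norm (A *v q))\<^sup>2 = V q t0"
      unfolding A power2_norm_eq_inner
      by (metis dot_lmul_matrix inner_commute matrix_vector_mul_assoc transpose_matrix_vector)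
    then have "norm (A *v q) \<le> sqrt r"
      using Q[OF \<open>q \<in> Q\<close>] by (simp add: real_le_rsqrt)
    have "p = (M t ** A') *v (A *v q)"
      using A' by (simp add: matrix_vector_mul_assoc flip: matrix_mul_assoc)
        (simp add: q_def spd_inv_vec[OF spd_g[OF \<open>t \<in> I\<close>]])
    then have "norm p \<le> onorm ((*v) (M t ** A')) * norm (A *v q)"
      using onorm[OF matrix_vector_mul_bounded_linear] by metis
    also have "\<dots> \<le> b"
      unfolding b_def
      by (intro mult_left_mono onorm_pos_le matrix_vector_mul_bounded_linear) fact
    finally show ?thesis .
  qed
  moreover have "continuous_on UNIV (f t)"
  proof (rule continuous_at_imp_continuous_on, rule ballI)
    fix p
    obtain D where "((\<lambda>(s,q). f s q) has_derivative D) (at (t,p))"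
      using vlasov[OF \<open>t \<in> I\<close>] by blast
    then have "isCont (\<lambda>(s,q). f s q) (t, p)" by (rule has_derivative_continuous)
    then show "isCont (f t) p"
      using isCont_o2[of p "\<lambda>q. (t, q)" "\<lambda>(s,q). f s q"] by simp
  qed
  ultimately have "matter m (g t) (f t) b"
    using m_pos spd_g f_nonneg \<open>t \<in> I\<close> by unfold_locales auto
  then show thesis by (rule that)
qed

lemma reduced_system:
  assumes R: "R \<ge> 0" "\<And>q. q \<in> Q \<Longrightarrow> V q t0 \<le> R" "R / (6 * m\<^sup>2) \<le> 1/1000"
    and F: "F t0 < 1/1000"
  shows "reduced_system (\<lambda>t. - H t) F (\<lambda>t. 4 * pi * trS t / (H t)\<^sup>2) F'
    V (\<lambda>q t. 2 * ((M t *v q) \<bullet> (k t *v (M t *v q)))) Q t0 m R"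
proof
  fix t assume t: "t0 \<le> t"
  then have tI: "t \<in> I" by (rule t_in_I)
  obtain b where "matter m (g t) (f t) b"
    using matter_at[OF tI R(2)] .
  then interpret mt: matter m "g t" "f t" b .
  have H: "H t < 0" using H_neg[OF tI] .
  then show "0 < - H t" by simp
  show "0 \<le> F t" by (rule F_nonneg[OF tI])
  show "0 \<le> 4 * pi * trS t / (H t)\<^sup>2"
    using mt.trace_inv_Smat_nonneg by simp
  show "((\<lambda>t. - H t) has_real_derivative - (- H t)\<^sup>2 * (1/2 + 3/4 * F t + 4 * pi * trS t / (H t)\<^sup>2)) (at t)"
    using DERIV_minus[OF H_deriv[OF tI]] by simp
  show "(F has_real_derivative F' t) (at t)" by (rule F_deriv[OF tI])
  show "F' t \<le> - (- H t) * F t * (1 - 3/2 * F t - 2 * (4 * pi * trS t / (H t)\<^sup>2))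
      + 4 * (- H t) * sqrt (F t) * (4 * pi * trS t / (H t)\<^sup>2)"
  proof -
    have "- trace (M t ** \<sigma> t ** M t ** S t) \<le> - H t * sqrt (F t) * trS t"
      using mt.shear_stress_le[OF sigma_symmetric[OF tI]] sqrt_ksq_sigma[OF tI] by simp
    then have "16 * pi / (H t)\<^sup>2 * - trace (M t ** \<sigma> t ** M t ** S t)
        \<le> 16 * pi / (H t)\<^sup>2 * (- H t * sqrt (F t) * trS t)"
      by (intro mult_left_mono) auto
    then show ?thesis by (simp add: F'_def algebra_simps)
  qed
  show "4 * pi * trS t / (H t)\<^sup>2 \<le> r / (6 * m\<^sup>2)" if "r \<ge> 0" "\<And>q. q \<in> Q \<Longrightarrow> V q t \<le> r" for r
  proof -
    have "p \<bullet> (g t *v p) \<le> r" if "f t p \<noteq> 0" for p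
      using \<open>\<And>q. q \<in> Q \<Longrightarrow> V q t \<le> r\<close>[of "g t *v p"] f_nonzero_iff[OF tI] that
      by (simp add: spd_inv_vec[OF spd_g[OF tI]] inner_commute)
    then have "4 * pi * trS t \<le> 4 * pi * (r / m\<^sup>2 * \<rho> t)"
      by (intro mult_left_mono mt.trace_inv_Smat_le_rho) auto
    also have "\<dots> = r / m\<^sup>2 * ((H t)\<^sup>2 * (1/6 - F t / 4))"
      unfolding rho_eq[OF tI, symmetric] by (simp add: mult_ac)
    \<comment> \<open>Dropping the shear, which only lowers the density at given \<open>H\<close>,
      produces the denominator \<open>6 * m^2\<close>.\<close>
    also have "\<dots> \<le> r / m\<^sup>2 * ((H t)\<^sup>2 * (1/6))"
      using F_nonneg[OF tI] \<open>r \<ge> 0\<close> by (intro mult_left_mono) auto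
    finally show ?thesis using H by (simp add: field_simps)
  qed
  fix q
  show "V q t \<ge> 0"
    by (rule spd_quadratic_form_nonneg[OF spd_inv[OF spd_g[OF tI]]])
  show "(V q has_real_derivative 2 * ((M t *v q) \<bullet> (k t *v (M t *v q)))) (at t)"
    by (rule V_deriv[OF tI])
  show "2 * ((M t *v q) \<bullet> (k t *v (M t *v q))) \<le> - 2 * (- H t) * (1/3 - sqrt (F t)) * V q t"
    by (rule V'_le[OF tI])
qed (use R F m_pos in auto)

end

theorem theorem1:
  "\<forall>\<epsilon>>0. \<forall>m>0. \<exists>\<delta>>0. \<forall>I g k f t0.
     open I \<and> is_interval I \<and> {t0..} \<subseteq> I \<and>
     EV_solution m I g k f \<and>
     (\<exists>t\<in>I. \<exists>p. f t p \<noteq> 0) \<and>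
     (\<forall>t\<in>I. mean_curv (g t) (k t) < 0) \<and>
     t0 = - 2 / mean_curv (g t0) (k t0) \<and>
     Fshear (g t0) (k t0) < \<delta> \<and> Pmom (g t0) (f t0) < ereal \<delta>
     \<longrightarrow>
     (\<exists>C. \<forall>\<^sub>F t in at_top. \<bar>mean_curv (g t) (k t) - (- 2 / t)\<bar> \<le> C * t powr (-2)) \<and>
     (\<exists>C. \<forall>\<^sub>F t in at_top. Pmom (g t) (f t) \<le> ereal (C * t powr (- 2/3 + \<epsilon>))) \<and>
     (\<exists>C. \<forall>\<^sub>F t in at_top. \<bar>Fshear (g t) (k t)\<bar> \<le> C * t powr (-2))"
proof (intro allI impI, goal_cases)
  case (1 \<epsilon> m)
  \<comment> \<open>The first bound secures \<open>F_init\<close>. The second gives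
    \<open>\<delta>^2 / (6 * m^2) \<le> 1/2400\<close>, hence \<open>R_small\<close> with
    \<open>R = \<delta>^2\<close>. The choice is independent of \<open>\<epsilon>\<close>.\<close>
  define \<delta> where "\<delta> = min (1/1000) (m / 20)"
  have "\<delta> > 0" using \<open>m > 0\<close> by (simp add: \<delta>_def)
  moreover
  {
    fix I g k f t0
    assume I: "open I" "is_interval I" "{t0..} \<subseteq> I"
      and sol: "EV_solution m I g k f"
      and H: "\<forall>t\<in>I. mean_curv (g t) (k t) < 0"
      and t0: "t0 = - 2 / mean_curv (g t0) (k t0)"
      and F0: "Fshear (g t0) (k t0) < \<delta>" and P0: "Pmom (g t0) (f t0) < ereal \<delta>"
    interpret bianchi_I_solution m I g k f t0
      using \<open>m > 0\<close> I sol H by unfold_locales auto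
    have V0: "V q t0 \<le> \<delta>\<^sup>2" if "q \<in> Q" for q
    proof -
      have "ereal (sqrt (V q t0)) < ereal \<delta>"
        using le_less_trans[OF SUP_upper[OF that] P0[unfolded Pmom_eq[OF t_in_I[OF order_refl]]]] .
      then show ?thesis by (simp add: sqrt_le_D)
    qed
    have "\<delta>\<^sup>2 / (6 * m\<^sup>2) \<le> (m / 20)\<^sup>2 / (6 * m\<^sup>2)"
      using \<open>\<delta> > 0\<close> \<open>m > 0\<close> by (intro divide_right_mono power_mono) (auto simp: \<delta>_def)
    also have "\<dots> \<le> 1/1000"
      using \<open>m > 0\<close> by (simp add: power_divide)
    finally have R: "\<delta>\<^sup>2 / (6 * m\<^sup>2) \<le> 1/1000" .
    have "F t0 < 1/1000" using F0 by (simp add: \<delta>_def)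
    interpret reduced_system "\<lambda>t. - H t" F "\<lambda>t. 4 * pi * trS t / (H t)\<^sup>2" F' V
      "\<lambda>q t. 2 * ((M t *v q) \<bullet> (k t *v (M t *v q)))" Q t0 m "\<delta>\<^sup>2"
      by (rule reduced_system) (use V0 R \<open>F t0 < 1/1000\<close> in auto)
    have "- H t0 * t0 = 2"
      using H_neg[OF t_in_I[of t0]] by (subst (2) t0) simp
    then obtain C1 where C1: "\<And>t. t0 \<le> t \<Longrightarrow> t > 0 \<and> - H t \<le> 2 / t \<and> \<bar>- H t - 2 / t\<bar> \<le> C1 * t powr (-2)"
      using h_asymp by blast
    obtain C2 where C2: "C2 \<ge> 0" "\<And>t. t0 \<le> t \<Longrightarrow> F t \<le> C2 * (- H t)\<^sup>2"
      using F_decay by blast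
    obtain C3 where C3: "C3 \<ge> 0" "\<And>q t. \<lbrakk>q \<in> Q; t0 \<le> t\<rbrakk> \<Longrightarrow> V q t \<le> C3 * (- H t) powr (4/3)"
      using V_decay by blast
    have "\<forall>\<^sub>F t in at_top. \<bar>H t - (- 2 / t)\<bar> \<le> C1 * t powr (-2)"
      using eventually_ge_at_top[of t0]
    proof eventually_elim
      case (elim t)
      then have "\<bar>- H t - 2 / t\<bar> \<le> C1 * t powr (-2)" using C1 by blast
      then show ?case by simp
    qed
    moreover have "\<forall>\<^sub>F t in at_top. Pmom (g t) (f t)
        \<le> ereal (sqrt (C3 * 2 powr (4/3)) * t powr (- 2/3 + \<epsilon>))"
      \<comment> \<open>The rate \<open>- 2/3\<close> is obtained first; \<open>t \<ge> 1\<close>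
        then allows the exponent to be increased by \<open>\<epsilon>\<close>.\<close>
      using eventually_ge_at_top[of "max 1 t0"]
    proof eventually_elim
      case (elim t)
      then have t: "t \<ge> 1" "t0 \<le> t" by auto
      have "sqrt (V q t) \<le> sqrt (C3 * 2 powr (4/3)) * t powr (- 2/3 + \<epsilon>)" if "q \<in> Q" for q
      proof -
        have "V q t \<le> C3 * (- H t) powr (4/3)" using C3 that t by blast
        also have "\<dots> \<le> C3 * (2 / t) powr (4/3)"
          using C1[OF t(2)] C3(1) H_neg[OF t_in_I[OF t(2)]] by (intro mult_left_mono powr_mono2) auto
        also have "\<dots> = C3 * 2 powr (4/3) * (t powr (- 2/3))\<^sup>2"
          using t by (simp add: powr_divide powr_minus power2_eq_square powr_add[symmetric] field_simps)
        also have "\<dots> \<le> C3 * 2 powr (4/3) * (t powr (- 2/3 + \<epsilon>))\<^sup>2"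
          using t C3(1) \<open>\<epsilon> > 0\<close> by (intro mult_left_mono power_mono powr_mono) auto
        finally show ?thesis
          using real_sqrt_le_mono by (fastforce simp: real_sqrt_mult)
      qed
      then show ?case
        unfolding Pmom_eq[OF t_in_I[OF t(2)]] by (intro SUP_least) simp
    qed
    moreover have "\<forall>\<^sub>F t in at_top. \<bar>F t\<bar> \<le> 4 * C2 * t powr (-2)"
      using eventually_ge_at_top[of t0]
    proof eventually_elim
      case (elim t)
      have "\<bar>F t\<bar> \<le> C2 * (- H t)\<^sup>2"
        using C2(2)[OF elim] F_nonneg[OF elim] by simp
      also have "\<dots> \<le> C2 * (2 / t)\<^sup>2"
        using C1[OF elim] C2(1) h_pos[OF elim] by (intro mult_left_mono power_mono) auto
      also have "\<dots> = 4 * C2 * t powr (-2)"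
        using C1[OF elim] by (simp add: powr_minus power_divide field_simps)
      finally show ?case .
    qed
    ultimately have "(\<exists>C. \<forall>\<^sub>F t in at_top. \<bar>H t - (- 2 / t)\<bar> \<le> C * t powr (-2)) \<and>
     (\<exists>C. \<forall>\<^sub>F t in at_top. Pmom (g t) (f t) \<le> ereal (C * t powr (- 2/3 + \<epsilon>))) \<and>
     (\<exists>C. \<forall>\<^sub>F t in at_top. \<bar>F t\<bar> \<le> C * t powr (-2))"
      by blast
  }
  ultimately show ?case
    by (intro exI[of _ \<delta>]) blast
qed

end
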